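(* Let $\mathrm{B}^{(2,2)}=\langle B\mid\mu=(\cdot),\Delta\rangle$ be a binary bialgebra whose algebra has a unit element $e_B$, which is almost co-medial with $M$-matrix $\mathit{M}^{(4)}\in B^{\otimes 4}$, i.e. $$\big(\tau_{medial}\circ(\Delta\otimes\Delta)\circ\Delta(b)\big)\cdot\mathit{M}^{(4)}=\mathit{M}^{(4)}\cdot\big((\Delta\otimes\Delta)\circ\Delta(b)\big)\qquad\forall b\in B ,$$ and suppose that the medial quasipolyangularity relations $$\big((\Delta\otimes\Delta)\circ\Delta\otimes\mathrm{id}_B\otimes\mathrm{id}_B\otimes\mathrm{id}_B\big)(\mathit{M}^{(4)})=\mathcal{M}_{1567}^{(7)}\cdot\mathcal{M}_{2567}^{(7)}\cdot\mathcal{M}_{3567}^{(7)}\cdot\mathcal{M}_{4567}^{(7)},$$ $$\big(\mathrm{id}_B\otimes\mathrm{id}_B\otimes\mathrm{id}_B\otimes(\Delta\otimes\Delta)\circ\Delta\big)(\mathit{M}^{(4)})=\mathcal{M}_{1234}^{(7)}\cdot\mathcal{M}_{1236}^{(7)}\cdot\mathcal{M}_{1235}^{(7)}\cdot\mathcal{M}_{1237}^{(7)}$$ hold in $B^{\otimes7}$, where $\mathcal{M}^{(7)}_{i_1i_2i_3i_4}$ denotes the extended $M$-matrix. Then the extended $M$-matrix satisfies the compatibility equations $$\mathcal{M}_{1234}^{(7)}\cdot\mathcal{M}_{1567}^{(7)}\cdot\mathcal{M}_{2567}^{(7)}\cdot\mathcal{M}_{3567}^{(7)}\cdot\mathcal{M}_{4567}^{(7)}=\mathcal{M}_{1567}^{(7)}\cdot\mathcal{M}_{3567}^{(7)}\cdot\mathcal{M}_{2567}^{(7)}\cdot\mathcal{M}_{4567}^{(7)}\cdot\mathcal{M}_{1234}^{(7)},$$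 $$\mathcal{M}_{4567}^{(7)}\cdot\mathcal{M}_{1234}^{(7)}\cdot\mathcal{M}_{1236}^{(7)}\cdot\mathcal{M}_{1235}^{(7)}\cdot\mathcal{M}_{1237}^{(7)}=\mathcal{M}_{1234}^{(7)}\cdot\mathcal{M}_{1235}^{(7)}\cdot\mathcal{M}_{1236}^{(7)}\cdot\mathcal{M}_{1237}^{(7)}\cdot\mathcal{M}_{4567}^{(7)}.$$
   Context: A binary bialgebra $\langle B\mid\mu,\Delta\rangle$ is a vector space $B$ over a field with an associative multiplication $\mu=(\cdot):B\otimes B\to B$ and a coassociative comultiplication $\Delta:B\to B\otimes B$ that is multiplicative, $\Delta(a\cdot b)=\Delta(a)\cdot\Delta(b)$; a counit is not required. Products in tensor powers $B^{\otimes p}$ are componentwise. The binary medial map is $\tau_{medial}=\mathrm{id}_B\otimes\tau_{op}\otimes\mathrm{id}_B$, i.e. $b_1\otimes b_2\otimes b_3\otimes b_4\mapsto b_1\otimes b_3\otimes b_2\otimes b_4$, with $\tau_{op}$ the flip. Write $\mathit{M}^{(4)}=\sum_\alpha\mathsf{m}_\alpha^{(1)}\otimes\mathsf{m}_\alpha^{(2)}\otimes\mathsf{m}_\alpha^{(3)}\otimes\mathsf{m}_\alpha^{(4)}$, $\mathsf{m}_\alpha^{(i)}\in B$. For distinct $i_1,i_2,i_3,i_4\in\{1,\dots,7\}$ the extended $M$-matrix $\mathcal{M}^{(7)}_{i_1i_2i_3i_4}\in B^{\otimes7}$ is the sum over $\alpha$ of the elementary tensors with $\mathsf{m}_\alpha^{(k)}$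 in the $i_k$-th tensor place ($k=1,2,3,4$) and $e_B$ in the three remaining places. *)

theory Defs
  imports Complex_Main "HOL-Library.Poly_Mapping"
begin

section \<open>Tensor powers of a vector space\<close>

text \<open>
  For a vector space \<open>B\<close> over a field \<open>k\<close>, the tensor power \<open>B\<^bsup>\<otimes>n\<^esup>\<close> is the quotient of the free
  vector space on \<open>B\<^sup>n\<close> by the relations expressing multilinearity. An \<open>n\<close>-tuple is a list of length
  \<open>n\<close>, and the free vector space consists of the finitely supported functions on such lists. An
  element of \<open>B\<^bsup>\<otimes>n\<^esup>\<close> is an equivalence class, hence a set of formal linear combinations.
  The scalar multiplication of \<open>B\<close> is an explicit parameter, as in \<^locale>\<open>vector_space\<close>.
\<close>

type_synonym ('k, 'b) tensor = "('b list \<Rightarrow>\<^sub>0 'k) set"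

definition free_scale :: "'k::field \<Rightarrow> ('x \<Rightarrow>\<^sub>0 'k) \<Rightarrow> ('x \<Rightarrow>\<^sub>0 'k)" where
  "free_scale c = Poly_Mapping.map ((*) c)"

lemma lookup_free_scale [simp]:
  "Poly_Mapping.lookup (free_scale c p) x = c * Poly_Mapping.lookup p x"
  by (simp add: free_scale_def Poly_Mapping.map.rep_eq when_def)

lemma vector_space_free_scale: "vector_space free_scale"
  by unfold_locales (auto intro!: poly_mapping_eqI simp: lookup_add algebra_simps)

definition free_extend :: "('x \<Rightarrow> ('y \<Rightarrow>\<^sub>0 'k::field)) \<Rightarrow> ('x \<Rightarrow>\<^sub>0 'k) \<Rightarrow> ('y \<Rightarrow>\<^sub>0 'k)" where
  "free_extend f p = (\<Sum>x\<in>Poly_Mapping.keys p. free_scale (Poly_Mapping.lookup p x) (f x))"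

definition free_tuples :: "nat \<Rightarrow> ('b list \<Rightarrow>\<^sub>0 'k::field) set" where
  "free_tuples n = {p. \<forall>xs\<in>Poly_Mapping.keys p. length xs = n}"

definition multilinear_relations ::
  "('k::field \<Rightarrow> 'b::ab_group_add \<Rightarrow> 'b) \<Rightarrow> nat \<Rightarrow> ('b list \<Rightarrow>\<^sub>0 'k) set" where
  "multilinear_relations scale n =
     {Poly_Mapping.single (xs @ (a + b) # ys) 1
        - Poly_Mapping.single (xs @ a # ys) 1 - Poly_Mapping.single (xs @ b # ys) 1
      | xs a b ys. length xs + 1 + length ys = n} \<union>
     {Poly_Mapping.single (xs @ scale c a # ys) 1
        - free_scale c (Poly_Mapping.single (xs @ a # ys) 1)
      | xs c a ys. length xs + 1 + length ys = n}"

definition tensor_rel ::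
  "('k::field \<Rightarrow> 'b::ab_group_add \<Rightarrow> 'b) \<Rightarrow> nat \<Rightarrow> (('b list \<Rightarrow>\<^sub>0 'k) \<times> ('b list \<Rightarrow>\<^sub>0 'k)) set" where
  "tensor_rel scale n =
     {(p, q). p \<in> free_tuples n \<and> q \<in> free_tuples n \<and>
        p - q \<in> module.span free_scale (multilinear_relations scale n)}"

definition tensor_power ::
  "('k::field \<Rightarrow> 'b::ab_group_add \<Rightarrow> 'b) \<Rightarrow> nat \<Rightarrow> ('k, 'b) tensor set" where
  "tensor_power scale n = free_tuples n // tensor_rel scale n"

definition tensor_class ::
  "('k::field \<Rightarrow> 'b::ab_group_add \<Rightarrow> 'b) \<Rightarrow> nat \<Rightarrow> ('b list \<Rightarrow>\<^sub>0 'k) \<Rightarrow> ('k, 'b) tensor" where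
  "tensor_class scale n p = tensor_rel scale n `` {p}"

text \<open>The elementary tensor \<open>x\<^sub>1 \<otimes> \<dots> \<otimes> x\<^sub>n\<close> of a list \<open>xs = [x\<^sub>1, \<dots>, x\<^sub>n]\<close>.\<close>

definition elementary ::
  "('k::field \<Rightarrow> 'b::ab_group_add \<Rightarrow> 'b) \<Rightarrow> 'b list \<Rightarrow> ('k, 'b) tensor" where
  "elementary scale xs = tensor_class scale (length xs) (Poly_Mapping.single xs 1)"

text \<open>
  Operations on tensors are given on representatives; the union over all representatives is the
  usual way to apply an operation to equivalence classes. In each operation, \<open>n\<close> (and \<open>m\<close>) are
  tensor degrees.
\<close>

definition tensor_add ::
  "('k::field \<Rightarrow> 'b::ab_group_add \<Rightarrow> 'b) \<Rightarrow> nat \<Rightarrow> ('k, 'b) tensor \<Rightarrow> ('k, 'b) tensor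
    \<Rightarrow> ('k, 'b) tensor" where
  "tensor_add scale n S T = (\<Union>p\<in>S. \<Union>q\<in>T. tensor_class scale n (p + q))"

definition tensor_scale ::
  "('k::field \<Rightarrow> 'b::ab_group_add \<Rightarrow> 'b) \<Rightarrow> nat \<Rightarrow> 'k \<Rightarrow> ('k, 'b) tensor
    \<Rightarrow> ('k, 'b) tensor" where
  "tensor_scale scale n c T = (\<Union>p\<in>T. tensor_class scale n (free_scale c p))"

text \<open>The product of \<open>B\<^bsup>\<otimes>n\<^esup>\<close>, componentwise on elementary tensors.\<close>

definition tensor_mult ::
  "('k::field \<Rightarrow> 'b::ring \<Rightarrow> 'b) \<Rightarrow> nat \<Rightarrow> ('k, 'b) tensor \<Rightarrow> ('k, 'b) tensor
    \<Rightarrow> ('k, 'b) tensor" where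
  "tensor_mult scale n S T =
     (\<Union>p\<in>S. \<Union>q\<in>T. tensor_class scale n
        (free_extend (\<lambda>xs. free_extend (\<lambda>ys. Poly_Mapping.single (map2 (*) xs ys) 1) q) p))"

text \<open>The canonical bilinear map \<open>B\<^bsup>\<otimes>m\<^esup> \<times> B\<^bsup>\<otimes>n\<^esup> \<rightarrow> B\<^bsup>\<otimes>(m+n)\<^esup>\<close>.\<close>

definition tensor_outer ::
  "('k::field \<Rightarrow> 'b::ab_group_add \<Rightarrow> 'b) \<Rightarrow> nat \<Rightarrow> nat \<Rightarrow> ('k, 'b) tensor \<Rightarrow> ('k, 'b) tensor
    \<Rightarrow> ('k, 'b) tensor" where
  "tensor_outer scale m n S T =
     (\<Union>p\<in>S. \<Union>q\<in>T. tensor_class scale (m + n)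
        (free_extend (\<lambda>xs. free_extend (\<lambda>ys. Poly_Mapping.single (xs @ ys) 1) q) p))"

text \<open>
  The linear map on a tensor power that sends \<open>x\<^sub>1 \<otimes> \<dots> \<otimes> x\<^sub>r\<close> to \<open>h [x\<^sub>1, \<dots>, x\<^sub>r]\<close>, where \<open>h\<close> is
  multilinear with values in \<open>B\<^bsup>\<otimes>n\<^esup>\<close>. The choice picks a representative of each value of \<open>h\<close>.
\<close>

definition tensor_lift ::
  "('k::field \<Rightarrow> 'b::ab_group_add \<Rightarrow> 'b) \<Rightarrow> nat \<Rightarrow> ('b list \<Rightarrow> ('k, 'b) tensor)
    \<Rightarrow> ('k, 'b) tensor \<Rightarrow> ('k, 'b) tensor" where
  "tensor_lift scale n h T =
     (\<Union>p\<in>T. tensor_class scale n (free_extend (\<lambda>xs. SOME q. q \<in> h xs) p))"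

text \<open>
  The tensor product \<open>f\<^sub>1 \<otimes> \<dots> \<otimes> f\<^sub>r\<close> of linear maps \<open>f\<^sub>i\<close> from \<open>B\<close> to \<open>B\<^bsup>\<otimes>d\<^sub>i\<^esup>\<close>, given as the list of
  the pairs \<open>(d\<^sub>i, f\<^sub>i)\<close>; it maps \<open>B\<^bsup>\<otimes>r\<^esup>\<close> to \<open>B\<^bsup>\<otimes>(d\<^sub>1+\<dots>+d\<^sub>r)\<^esup>\<close>.
\<close>

fun tensor_concat ::
  "('k::field \<Rightarrow> 'b::ab_group_add \<Rightarrow> 'b) \<Rightarrow> (nat \<times> ('k, 'b) tensor) list
    \<Rightarrow> ('k, 'b) tensor" where
  "tensor_concat scale [] = elementary scale []"
| "tensor_concat scale ((d, T) # Ts) =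
     tensor_outer scale d (sum_list (map fst Ts)) T (tensor_concat scale Ts)"

definition tensor_of_maps ::
  "('k::field \<Rightarrow> 'b::ab_group_add \<Rightarrow> 'b) \<Rightarrow> (nat \<times> ('b \<Rightarrow> ('k, 'b) tensor)) list
    \<Rightarrow> ('k, 'b) tensor \<Rightarrow> ('k, 'b) tensor" where
  "tensor_of_maps scale fs =
     tensor_lift scale (sum_list (map fst fs))
       (\<lambda>xs. tensor_concat scale (map2 (\<lambda>(d, f) x. (d, f x)) fs xs))"

text \<open>The identity of \<open>B\<close> as a tensor factor, i.e. the identification of \<open>B\<close> with \<open>B\<^bsup>\<otimes>1\<^esup>\<close>.\<close>

definition ident ::
  "('k::field \<Rightarrow> 'b::ab_group_add \<Rightarrow> 'b) \<Rightarrow> nat \<times> ('b \<Rightarrow> ('k, 'b) tensor)" where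
  "ident scale = (1, \<lambda>b. elementary scale [b])"


section \<open>Binary bialgebras\<close>

text \<open>
  The class \<^class>\<open>ring\<close> has no unit, and it makes the multiplication associative and biadditive.
  Neither a unit nor a counit is part of the structure.
\<close>

locale binary_bialgebra = vector_space scale
  for scale :: "'k::field \<Rightarrow> 'b::ring \<Rightarrow> 'b" +
  fixes \<Delta> :: "'b \<Rightarrow> ('k, 'b) tensor"
  assumes scale_mult_left: "scale c a * b = scale c (a * b)"
    and scale_mult_right: "a * scale c b = scale c (a * b)"
    and comult_closed: "\<Delta> a \<in> tensor_power scale 2"
    and comult_add: "\<Delta> (a + b) = tensor_add scale 2 (\<Delta> a) (\<Delta> b)"
    and comult_scale: "\<Delta> (scale c a) = tensor_scale scale 2 c (\<Delta> a)"
    and comult_coassoc: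
      "tensor_of_maps scale [(2, \<Delta>), ident scale] (\<Delta> a)
        = tensor_of_maps scale [ident scale, (2, \<Delta>)] (\<Delta> a)"
    and comult_mult: "\<Delta> (a * b) = tensor_mult scale 2 (\<Delta> a) (\<Delta> b)"

text \<open>The map \<open>(\<Delta> \<otimes> \<Delta>) \<circ> \<Delta>\<close> from \<open>B\<close> to \<open>B\<^bsup>\<otimes>4\<^esup>\<close>.\<close>

definition comult4 ::
  "('k::field \<Rightarrow> 'b::ab_group_add \<Rightarrow> 'b) \<Rightarrow> ('b \<Rightarrow> ('k, 'b) tensor) \<Rightarrow> 'b
    \<Rightarrow> ('k, 'b) tensor" where
  "comult4 scale \<Delta> b = tensor_of_maps scale [(2, \<Delta>), (2, \<Delta>)] (\<Delta> b)"

definition medial ::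
  "('k::field \<Rightarrow> 'b::ab_group_add \<Rightarrow> 'b) \<Rightarrow> ('k, 'b) tensor \<Rightarrow> ('k, 'b) tensor" where
  "medial scale =
     tensor_lift scale 4 (\<lambda>xs. elementary scale [xs ! 0, xs ! 2, xs ! 1, xs ! 3])"

text \<open>
  The extended tensor, for a list \<open>is\<close> of distinct places in \<open>{1, \<dots>, n}\<close>: the \<open>k\<close>-th tensor factor
  is put in the place \<open>is ! k\<close> and \<open>e\<close> in the remaining places of \<open>B\<^bsup>\<otimes>n\<^esup>\<close>.
  Places are counted from 1, list positions from 0.
\<close>

definition extended ::
  "('k::field \<Rightarrow> 'b::ab_group_add \<Rightarrow> 'b) \<Rightarrow> 'b \<Rightarrow> nat \<Rightarrow> nat list \<Rightarrow> ('k, 'b) tensor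
    \<Rightarrow> ('k, 'b) tensor" where
  "extended scale e n is =
     tensor_lift scale n (\<lambda>xs. elementary scale
       (map (\<lambda>j. case map_of (zip is xs) j of Some x \<Rightarrow> x | None \<Rightarrow> e) [1..<Suc n]))"

end

theory Submission
  imports Defs
begin

text \<open>
  Write \<open>\<Delta>4 = (\<Delta> \<otimes> \<Delta>) \<circ> \<Delta>\<close>. By the first quasipolyangularity relation, the product of
  \<open>\<M> 1 5 6 7\<close>, \<dots>, \<open>\<M> 4 5 6 7\<close> is \<open>(\<Delta>4 \<otimes> id \<otimes> id \<otimes> id) M\<close>, a sum of tensors \<open>\<Delta>4 b \<otimes> w\<close>. Since
  \<open>\<M> 1 2 3 4 = M \<otimes> e \<otimes> e \<otimes> e\<close>, multiplying such a summand by \<open>\<M> 1 2 3 4\<close> from the left gives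
  \<open>(M \<cdot> \<Delta>4 b) \<otimes> w\<close>, which is \<open>(medial (\<Delta>4 b) \<cdot> M) \<otimes> w\<close> by almost co-mediality. So \<open>\<M> 1 2 3 4\<close>
  moves past the whole sum at the price of exchanging the places 2 and 3 in it. This exchange
  is a homomorphism of the algebra \<open>B\<^bsup>\<otimes>7\<^esup>\<close>, hence acts on each factor of the product, where it swaps
  \<open>\<M> 2 5 6 7\<close> and \<open>\<M> 3 5 6 7\<close> and fixes the other two. The second equation is the mirror image,
  with \<open>\<Delta>4\<close> in the last four places and the places 5 and 6 exchanged. The lemma
  \<open>tensor_of_maps_exchange\<close> is the step common to both: it allows any number of further
  linear maps before and after the one that is intertwined.

  To calculate with tensors, one chooses representatives in the free vector space. There the
  product, the outer product and the permutations of places are linear extensions of operations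
  on lists, and their identities are identities of lists. All that has to be added is that each
  operation respects the multilinear relations, and that the choices made by \<open>tensor_lift\<close> only
  matter modulo these relations.
\<close>


section \<open>Linear extension from a basis\<close>

interpretation free: vector_space "free_scale :: 'k::field \<Rightarrow> ('x \<Rightarrow>\<^sub>0 'k) \<Rightarrow> ('x \<Rightarrow>\<^sub>0 'k)"
  by (rule vector_space_free_scale)

lemma free_extend_superset:
  assumes "finite A" "Poly_Mapping.keys p \<subseteq> A"
  shows "free_extend f p = (\<Sum>x\<in>A. free_scale (Poly_Mapping.lookup p x) (f x))"
  unfolding free_extend_def using assms
  by (intro sum.mono_neutral_left) (auto simp: in_keys_iff)

lemma free_extend_zero [simp]: "free_extend f 0 = 0"
  by (simp add: free_extend_def)

lemma free_extend_add: "free_extend f (p + q) = free_extend f p + free_extend f q"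
proof -
  let ?A = "Poly_Mapping.keys p \<union> Poly_Mapping.keys q"
  have "free_extend f r = (\<Sum>x\<in>?A. free_scale (Poly_Mapping.lookup r x) (f x))"
    if "r \<in> {p + q, p, q}" for r
    using that Poly_Mapping.keys_add[of p q] by (intro free_extend_superset) auto
  then show ?thesis
    by (simp add: lookup_add free.scale_left_distrib sum.distrib)
qed

lemma free_extend_scale: "free_extend f (free_scale c p) = free_scale c (free_extend f p)"
proof -
  have "Poly_Mapping.keys (free_scale c p) \<subseteq> Poly_Mapping.keys p"
    by (auto simp: in_keys_iff)
  then have "free_extend f (free_scale c p)
      = (\<Sum>x\<in>Poly_Mapping.keys p. free_scale (Poly_Mapping.lookup (free_scale c p) x) (f x))"
    by (intro free_extend_superset) auto
  then show ?thesis
    by (simp add: free_extend_def free.scale_sum_right)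
qed

lemma free_extend_diff: "free_extend f (p - q) = free_extend f p - free_extend f q"
  using free_extend_add[of f "p - q" q] by (simp add: algebra_simps)

lemma free_extend_sum: "free_extend f (\<Sum>i\<in>I. g i) = (\<Sum>i\<in>I. free_extend f (g i))"
  by (induction I rule: infinite_finite_induct) (auto simp: free_extend_add)

lemma free_extend_single [simp]: "free_extend f (Poly_Mapping.single x 1) = f x"
  by (simp add: free_extend_def)

text \<open>
  This equation and the next one reduce identities between composites of bilinear operations to
  identities of basis elements: the first flattens nested extensions, the second reorders them.
\<close>

lemma free_extend_compose:
  "free_extend g (free_extend f p) = free_extend (\<lambda>x. free_extend g (f x)) p"
proof -
  have "free_extend g (free_extend f p)
      = (\<Sum>x\<in>Poly_Mapping.keys p. free_extend g (free_scale (Poly_Mapping.lookup p x) (f x)))"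
    by (simp add: free_extend_def[of f] free_extend_sum)
  then show ?thesis
    by (simp add: free_extend_scale free_extend_def[of "\<lambda>x. free_extend g (f x)"])
qed

lemma free_extend_swap:
  "free_extend (\<lambda>x. free_extend (\<lambda>y. g x y) q) p = free_extend (\<lambda>y. free_extend (\<lambda>x. g x y) p) q"
  unfolding free_extend_def free.scale_sum_right
  by (subst sum.swap) (simp add: free.scale_scale mult.commute)

lemma free_extend_cong:
  assumes "\<And>x. x \<in> Poly_Mapping.keys p \<Longrightarrow> f x = g x"
  shows "free_extend f p = free_extend g p"
  using assms by (simp add: free_extend_def)

lemma free_extend_cong_tuples:
  assumes "p \<in> free_tuples n" "\<And>x. length x = n \<Longrightarrow> f x = g x"
  shows "free_extend f p = free_extend g p"
  using assms by (intro free_extend_cong) (auto simp: free_tuples_def)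

lemma free_tuples_zero: "0 \<in> free_tuples n"
  by (simp add: free_tuples_def)

lemma free_tuples_add: "p \<in> free_tuples n \<Longrightarrow> q \<in> free_tuples n \<Longrightarrow> p + q \<in> free_tuples n"
  using Poly_Mapping.keys_add[of p q] by (fastforce simp: free_tuples_def)

lemma free_tuples_scale: "p \<in> free_tuples n \<Longrightarrow> free_scale c p \<in> free_tuples n"
  by (auto simp: free_tuples_def in_keys_iff)

lemma free_tuples_single: "length xs = n \<Longrightarrow> Poly_Mapping.single xs c \<in> free_tuples n"
  by (auto simp: free_tuples_def)

lemma free_tuples_extend:
  assumes "p \<in> free_tuples m" "\<And>xs. length xs = m \<Longrightarrow> f xs \<in> free_tuples n"
  shows "free_extend f p \<in> free_tuples n"
proof -
  have "(\<Sum>x\<in>A. free_scale (c x) (f x)) \<in> free_tuples n"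
    if "\<And>x. x \<in> A \<Longrightarrow> length x = m" for A and c :: "'a list \<Rightarrow> 'b"
    using that assms(2)
    by (induction A rule: infinite_finite_induct)
       (auto intro!: free_tuples_add free_tuples_scale free_tuples_zero)
  with assms(1) show ?thesis
    unfolding free_extend_def by (auto simp: free_tuples_def)
qed

definition free_mult :: "('b::ring list \<Rightarrow>\<^sub>0 'k::field) \<Rightarrow> ('b list \<Rightarrow>\<^sub>0 'k) \<Rightarrow> ('b list \<Rightarrow>\<^sub>0 'k)" where
  "free_mult p q =
     free_extend (\<lambda>xs. free_extend (\<lambda>ys. Poly_Mapping.single (map2 (*) xs ys) 1) q) p"

definition free_outer :: "('b list \<Rightarrow>\<^sub>0 'k::field) \<Rightarrow> ('b list \<Rightarrow>\<^sub>0 'k) \<Rightarrow> ('b list \<Rightarrow>\<^sub>0 'k)" where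
  "free_outer p q = free_extend (\<lambda>xs. free_extend (\<lambda>ys. Poly_Mapping.single (xs @ ys) 1) q) p"

definition free_map :: "('x \<Rightarrow> 'y) \<Rightarrow> ('x \<Rightarrow>\<^sub>0 'k::field) \<Rightarrow> ('y \<Rightarrow>\<^sub>0 'k)" where
  "free_map \<phi> = free_extend (\<lambda>xs. Poly_Mapping.single (\<phi> xs) 1)"

lemma free_mult_tuples:
  "p \<in> free_tuples n \<Longrightarrow> q \<in> free_tuples n \<Longrightarrow> free_mult p q \<in> free_tuples n"
  unfolding free_mult_def by (intro free_tuples_extend free_tuples_single) auto

lemma free_outer_tuples:
  "p \<in> free_tuples m \<Longrightarrow> q \<in> free_tuples n \<Longrightarrow> free_outer p q \<in> free_tuples (m + n)"
  unfolding free_outer_def by (intro free_tuples_extend free_tuples_single) auto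

lemma free_map_tuples:
  "p \<in> free_tuples m \<Longrightarrow> (\<And>xs. length xs = m \<Longrightarrow> length (\<phi> xs) = n) \<Longrightarrow> free_map \<phi> p \<in> free_tuples n"
  unfolding free_map_def by (intro free_tuples_extend free_tuples_single) auto

lemma map2_mult_assoc:
  fixes xs :: "'b::ring list"
  shows "map2 (*) (map2 (*) xs ys) zs = map2 (*) xs (map2 (*) ys zs)"
  by (intro nth_equalityI) (auto simp: mult.assoc)

lemma free_mult_assoc: "free_mult (free_mult p q) r = free_mult p (free_mult q r)"
  unfolding free_mult_def by (simp add: free_extend_compose map2_mult_assoc)

lemma free_outer_assoc: "free_outer (free_outer p q) r = free_outer p (free_outer q r)"
  unfolding free_outer_def by (simp add: free_extend_compose)

lemma free_extend_basis: "free_extend (\<lambda>x. Poly_Mapping.single x 1) p = p"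
proof (rule poly_mapping_eqI)
  fix k
  have "(\<Sum>x\<in>Poly_Mapping.keys p. Poly_Mapping.lookup p x * (if x = k then 1 else 0))
      = (\<Sum>x\<in>Poly_Mapping.keys p. if x = k then Poly_Mapping.lookup p x else 0)"
    by (intro sum.cong) auto
  then show "Poly_Mapping.lookup (free_extend (\<lambda>x. Poly_Mapping.single x 1) p) k
      = Poly_Mapping.lookup p k"
    by (simp add: free_extend_def lookup_sum lookup_single when_def in_keys_iff)
qed

lemma free_outer_Nil: "free_outer (Poly_Mapping.single [] 1) p = p"
  by (simp add: free_outer_def free_extend_basis)


section \<open>Congruence modulo the multilinear relations\<close>

text \<open>
  The relation \<^const>\<open>tensor_rel\<close> without the restriction to tuples of length \<open>n\<close>, so that it is
  compatible with addition and scaling without side conditions.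
\<close>

definition tensor_cong ::
  "('k::field \<Rightarrow> 'b::ab_group_add \<Rightarrow> 'b) \<Rightarrow> nat \<Rightarrow> ('b list \<Rightarrow>\<^sub>0 'k) \<Rightarrow> ('b list \<Rightarrow>\<^sub>0 'k) \<Rightarrow> bool" where
  "tensor_cong scale n p q \<longleftrightarrow> p - q \<in> free.span (multilinear_relations scale n)"

lemma tensor_cong_refl [simp]: "tensor_cong scale n p p"
  by (simp add: tensor_cong_def free.span_zero)

lemma tensor_cong_sym: "tensor_cong scale n p q \<Longrightarrow> tensor_cong scale n q p"
  unfolding tensor_cong_def using free.span_neg[of "p - q"] by simp

lemma tensor_cong_trans [trans]:
  "tensor_cong scale n p q \<Longrightarrow> tensor_cong scale n q r \<Longrightarrow> tensor_cong scale n p r"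
  unfolding tensor_cong_def using free.span_add[of "p - q" _ "q - r"] by simp

lemma tensor_cong_add:
  "tensor_cong scale n p p' \<Longrightarrow> tensor_cong scale n q q' \<Longrightarrow> tensor_cong scale n (p + q) (p' + q')"
  unfolding tensor_cong_def using free.span_add[of "p - p'" _ "q - q'"] by (simp add: algebra_simps)

lemma tensor_cong_scale:
  "tensor_cong scale n p q \<Longrightarrow> tensor_cong scale n (free_scale c p) (free_scale c q)"
  unfolding tensor_cong_def using free.span_scale[of "p - q" _ c]
  by (simp add: free.scale_right_diff_distrib)

lemma tensor_cong_extend:
  assumes "p \<in> free_tuples m" "\<And>xs. length xs = m \<Longrightarrow> tensor_cong scale n (f xs) (g xs)"
  shows "tensor_cong scale n (free_extend f p) (free_extend g p)"
proof -
  have "tensor_cong scale n (\<Sum>x\<in>A. free_scale (c x) (f x)) (\<Sum>x\<in>A. free_scale (c x) (g x))"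
    if "\<And>x. x \<in> A \<Longrightarrow> length x = m" for A c
    using that assms(2)
    by (induction A rule: infinite_finite_induct)
       (auto intro!: tensor_cong_add tensor_cong_scale)
  with assms(1) show ?thesis
    unfolding free_extend_def by (auto simp: free_tuples_def)
qed

text \<open>
  Multilinearity up to the relations of the target: this is what survives of the multilinearity of
  a tensor-valued map when its values are replaced by arbitrary representatives.
\<close>

definition multilinear_mod ::
  "('k::field \<Rightarrow> 'b::ab_group_add \<Rightarrow> 'b) \<Rightarrow> nat \<Rightarrow> nat \<Rightarrow> ('b list \<Rightarrow> ('b list \<Rightarrow>\<^sub>0 'k)) \<Rightarrow> bool" where
  "multilinear_mod scale m n h \<longleftrightarrow>
     (\<forall>xs i a b c. length xs = m \<longrightarrow> i < m \<longrightarrow>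
        tensor_cong scale n (h (xs[i := a + b])) (h (xs[i := a]) + h (xs[i := b])) \<and>
        tensor_cong scale n (h (xs[i := scale c a])) (free_scale c (h (xs[i := a]))))"

text \<open>
  The universal property of the tensor power. The span of the relations is mapped into a
  span because the extension is linear and sends each generator to the difference of the two
  sides of one of the congruences that define multilinearity.
\<close>

lemma multilinear_mod_extend:
  assumes h: "multilinear_mod scale m n h" and pq: "tensor_cong scale m p q"
  shows "tensor_cong scale n (free_extend h p) (free_extend h q)"
proof -
  have "free_extend h r \<in> free.span (multilinear_relations scale n)"
    if "r \<in> free.span (multilinear_relations scale m)" for r
    using that
  proof (induction rule: free.span_induct_alt)
    case base
    then show ?case by (simp add: free.span_zero)
  next
    case (step c r s)
    have "free_extend h r \<in> free.span (multilinear_relations scale n)"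
      using step(1) unfolding multilinear_relations_def[of _ m]
    proof (elim UnE CollectE exE conjE)
      fix xs a b ys
      assume *: "r = Poly_Mapping.single (xs @ (a + b) # ys) 1
        - Poly_Mapping.single (xs @ a # ys) 1 - Poly_Mapping.single (xs @ b # ys) 1"
        "length xs + 1 + length ys = m"
      have upd: "(xs @ a # ys)[length xs := z] = xs @ z # ys" for z by simp
      show ?thesis
        using h[unfolded multilinear_mod_def, rule_format, of "xs @ a # ys" "length xs" a b] *
        unfolding upd by (simp add: free_extend_diff free_extend_add tensor_cong_def diff_diff_eq)
    next
      fix xs c a ys
      assume *: "r = Poly_Mapping.single (xs @ scale c a # ys) 1
        - free_scale c (Poly_Mapping.single (xs @ a # ys) 1)"
        "length xs + 1 + length ys = m"
      have upd: "(xs @ a # ys)[length xs := z] = xs @ z # ys" for z by simp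
      show ?thesis
        using h[unfolded multilinear_mod_def, rule_format, of "xs @ a # ys" "length xs" a _ c] *
        unfolding upd by (simp add: free_extend_diff free_extend_scale tensor_cong_def)
    qed
    then show ?case
      using step(2) by (simp add: free_extend_add free_extend_scale free.span_add free.span_scale)
  qed
  then show ?thesis
    using pq by (simp add: tensor_cong_def flip: free_extend_diff)
qed

text \<open>
  All the operations on lists used below change exactly one entry of the result, and that entry
  linearly, when one entry of the argument changes. Then elementary tensors are multilinear.
\<close>

lemma multilinear_mod_single:
  fixes scale :: "'k::field \<Rightarrow> 'b::ab_group_add \<Rightarrow> 'b"
  assumes "\<And>xs i. length xs = m \<Longrightarrow> i < m \<Longrightarrow> \<exists>k L zs. k < n \<and> length zs = n
      \<and> (\<forall>a. \<phi> (xs[i := a]) = zs[k := L a])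
      \<and> (\<forall>a b. L (a + b) = L a + L b) \<and> (\<forall>c a. L (scale c a) = scale c (L a))"
  shows "multilinear_mod scale m n (\<lambda>xs. Poly_Mapping.single (\<phi> xs) 1)"
  unfolding multilinear_mod_def
proof (intro allI impI)
  fix xs :: "'b list" and i a b c
  assume "length xs = m" "i < m"
  from assms[OF this] obtain k L zs where *: "k < n" "length zs = n"
    "\<And>a. \<phi> (xs[i := a]) = zs[k := L a]"
    "\<And>a b. L (a + b) = L a + L b" "\<And>c a. L (scale c a) = scale c (L a)"
    by blast
  have upd: "zs[k := z] = take k zs @ z # drop (Suc k) zs" for z
    using * by (simp add: upd_conv_take_nth_drop)
  have len: "length (take k zs) + 1 + length (drop (Suc k) zs) = n"
    using * by simp
  show "tensor_cong scale n (Poly_Mapping.single (\<phi> (xs[i := a + b])) 1)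
      (Poly_Mapping.single (\<phi> (xs[i := a])) 1 + Poly_Mapping.single (\<phi> (xs[i := b])) 1)
    \<and> tensor_cong scale n (Poly_Mapping.single (\<phi> (xs[i := scale c a])) 1)
      (free_scale c (Poly_Mapping.single (\<phi> (xs[i := a])) 1))"
    unfolding *(3-5) upd tensor_cong_def multilinear_relations_def diff_diff_eq[symmetric]
    using len by (intro conjI free.span_base) blast+
qed

text \<open>
  The part of the structure of a bialgebra that makes the componentwise product of tensors
  well defined.
\<close>

locale scaled_ring =
  fixes scale :: "'k::field \<Rightarrow> 'b::ring \<Rightarrow> 'b"
  assumes scale_mult_left: "scale c a * b = scale c (a * b)"
    and scale_mult_right: "a * scale c b = scale c (a * b)"

lemma (in scaled_ring) multilinear_mod_mult_left:
  assumes "length zs = n"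
  shows "multilinear_mod scale n n (\<lambda>xs. Poly_Mapping.single (map2 (*) xs zs) 1)"
proof (rule multilinear_mod_single)
  fix xs :: "'b list" and i
  assume "length xs = n" "i < n"
  with assms show "\<exists>k L ws. k < n \<and> length ws = n \<and> (\<forall>a. map2 (*) (xs[i := a]) zs = ws[k := L a])
      \<and> (\<forall>a b. L (a + b) = L a + L b) \<and> (\<forall>c a. L (scale c a) = scale c (L a))"
    by (intro exI[of _ i] exI[of _ "\<lambda>a. a * zs ! i"] exI[of _ "map2 (*) xs zs"])
       (auto simp: list_eq_iff_nth_eq nth_list_update distrib_right scale_mult_left)
qed

lemma (in scaled_ring) multilinear_mod_mult_right:
  assumes "length zs = n"
  shows "multilinear_mod scale n n (\<lambda>xs. Poly_Mapping.single (map2 (*) zs xs) 1)"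
proof (rule multilinear_mod_single)
  fix xs :: "'b list" and i
  assume "length xs = n" "i < n"
  with assms show "\<exists>k L ws. k < n \<and> length ws = n \<and> (\<forall>a. map2 (*) zs (xs[i := a]) = ws[k := L a])
      \<and> (\<forall>a b. L (a + b) = L a + L b) \<and> (\<forall>c a. L (scale c a) = scale c (L a))"
    by (intro exI[of _ i] exI[of _ "\<lambda>a. zs ! i * a"] exI[of _ "map2 (*) zs xs"])
       (auto simp: list_eq_iff_nth_eq nth_list_update distrib_left scale_mult_right)
qed

lemma multilinear_mod_append_left:
  assumes "length zs = n"
  shows "multilinear_mod scale m (m + n) (\<lambda>xs. Poly_Mapping.single (xs @ zs) 1)"
proof (rule multilinear_mod_single)
  fix xs :: "'a list" and i
  assume "length xs = m" "i < m"
  with assms show "\<exists>k L ws. k < m + n \<and> length ws = m + n \<and> (\<forall>a. xs[i := a] @ zs = ws[k := L a])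
      \<and> (\<forall>a b. L (a + b) = L a + L b) \<and> (\<forall>c a. L (scale c a) = scale c (L a))"
    by (intro exI[of _ i] exI[of _ "\<lambda>a. a"] exI[of _ "xs @ zs"]) (auto simp: list_update_append)
qed

lemma multilinear_mod_append_right:
  assumes "length zs = m"
  shows "multilinear_mod scale n (m + n) (\<lambda>xs. Poly_Mapping.single (zs @ xs) 1)"
proof (rule multilinear_mod_single)
  fix xs :: "'a list" and i
  assume "length xs = n" "i < n"
  with assms show "\<exists>k L ws. k < m + n \<and> length ws = m + n \<and> (\<forall>a. zs @ xs[i := a] = ws[k := L a])
      \<and> (\<forall>a b. L (a + b) = L a + L b) \<and> (\<forall>c a. L (scale c a) = scale c (L a))"
    by (intro exI[of _ "m + i"] exI[of _ "\<lambda>a. a"] exI[of _ "zs @ xs"])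
       (auto simp: list_update_append)
qed

text \<open>
  The inner argument \<open>q\<close> is replaced first, summand by summand of the extension along \<open>p\<close>. Then
  interchanging the two extensions makes \<open>p\<close> the inner argument, to which the same step applies.
\<close>

lemma tensor_cong_bilinear:
  assumes "\<And>zs. length zs = n \<Longrightarrow> multilinear_mod scale m l (\<lambda>xs. g xs zs)"
    and "\<And>zs. length zs = m \<Longrightarrow> multilinear_mod scale n l (g zs)"
    and "p \<in> free_tuples m" "q' \<in> free_tuples n"
    and "tensor_cong scale m p p'" "tensor_cong scale n q q'"
  shows "tensor_cong scale l (free_extend (\<lambda>xs. free_extend (g xs) q) p)
           (free_extend (\<lambda>xs. free_extend (g xs) q') p')"
proof -
  have "tensor_cong scale l (free_extend (\<lambda>xs. free_extend (g xs) q) p)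
      (free_extend (\<lambda>xs. free_extend (g xs) q') p)"
    using assms by (intro tensor_cong_extend multilinear_mod_extend) auto
  also have "tensor_cong scale l \<dots> (free_extend (\<lambda>xs. free_extend (g xs) q') p')"
    unfolding free_extend_swap[of _ q']
    using assms by (intro tensor_cong_extend multilinear_mod_extend) auto
  finally show ?thesis .
qed

lemma (in scaled_ring) tensor_cong_mult:
  assumes "p \<in> free_tuples n" "q' \<in> free_tuples n"
    and "tensor_cong scale n p p'" "tensor_cong scale n q q'"
  shows "tensor_cong scale n (free_mult p q) (free_mult p' q')"
  unfolding free_mult_def
  by (rule tensor_cong_bilinear[OF multilinear_mod_mult_left multilinear_mod_mult_right])
     (use assms in auto)

lemma tensor_cong_outer:
  assumes "p \<in> free_tuples m" "q' \<in> free_tuples n"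
    and "tensor_cong scale m p p'" "tensor_cong scale n q q'"
  shows "tensor_cong scale (m + n) (free_outer p q) (free_outer p' q')"
  unfolding free_outer_def
  by (rule tensor_cong_bilinear[OF multilinear_mod_append_left multilinear_mod_append_right])
     (use assms in auto)


section \<open>Tensor operations in terms of representatives\<close>

lemma mem_tensor_class:
  "p \<in> free_tuples n \<Longrightarrow> q \<in> tensor_class scale n p \<longleftrightarrow> q \<in> free_tuples n \<and> tensor_cong scale n p q"
  by (simp add: tensor_class_def tensor_rel_def tensor_cong_def)

lemma tensor_class_eq_iff:
  assumes "p \<in> free_tuples n" "q \<in> free_tuples n"
  shows "tensor_class scale n p = tensor_class scale n q \<longleftrightarrow> tensor_cong scale n p q"
proof
  assume "tensor_class scale n p = tensor_class scale n q"
  then have "q \<in> tensor_class scale n p"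
    using assms by (simp add: mem_tensor_class)
  then show "tensor_cong scale n p q"
    using assms by (simp add: mem_tensor_class)
next
  assume "tensor_cong scale n p q"
  then show "tensor_class scale n p = tensor_class scale n q"
    using assms by (auto simp: mem_tensor_class) (metis tensor_cong_trans tensor_cong_sym)+
qed

lemma tensor_power_iff: "T \<in> tensor_power scale n \<longleftrightarrow> (\<exists>p\<in>free_tuples n. T = tensor_class scale n p)"
  by (auto simp: tensor_power_def quotient_def tensor_class_def)

lemma tensor_class_in_power: "p \<in> free_tuples n \<Longrightarrow> tensor_class scale n p \<in> tensor_power scale n"
  by (auto simp: tensor_power_iff)

definition tensor_rep :: "('k::field, 'b) tensor \<Rightarrow> ('b list \<Rightarrow>\<^sub>0 'k)" where
  "tensor_rep T = (SOME q. q \<in> T)"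

lemma tensor_rep_class:
  assumes "p \<in> free_tuples n"
  shows "tensor_rep (tensor_class scale n p) \<in> free_tuples n"
    and "tensor_cong scale n p (tensor_rep (tensor_class scale n p))"
proof -
  have "p \<in> tensor_class scale n p"
    using assms by (simp add: mem_tensor_class)
  then have "tensor_rep (tensor_class scale n p) \<in> tensor_class scale n p"
    unfolding tensor_rep_def by (rule someI)
  then show "tensor_rep (tensor_class scale n p) \<in> free_tuples n"
    "tensor_cong scale n p (tensor_rep (tensor_class scale n p))"
    using assms by (simp_all add: mem_tensor_class)
qed

lemma tensor_rep:
  assumes "T \<in> tensor_power scale n"
  shows tensor_rep_tuples: "tensor_rep T \<in> free_tuples n"
    and tensor_class_rep: "tensor_class scale n (tensor_rep T) = T"
proof -
  obtain p where p: "p \<in> free_tuples n" "T = tensor_class scale n p"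
    using assms by (auto simp: tensor_power_iff)
  show "tensor_rep T \<in> free_tuples n"
    using tensor_rep_class(1)[OF p(1)] p by simp
  then show "tensor_class scale n (tensor_rep T) = T"
    using tensor_rep_class[OF p(1)] p by (metis tensor_class_eq_iff)
qed

text \<open>
  Operations on tensors are unions over all representatives. If the operation respects the
  congruence, then all the classes in the union coincide.
\<close>

lemma UN_tensor_class:
  assumes "p \<in> free_tuples m"
    and "\<And>q. q \<in> free_tuples m \<Longrightarrow> F q \<in> free_tuples n"
    and "\<And>q. q \<in> free_tuples m \<Longrightarrow> tensor_cong scale m p q \<Longrightarrow> tensor_cong scale n (F p) (F q)"
  shows "(\<Union>q\<in>tensor_class scale m p. tensor_class scale n (F q)) = tensor_class scale n (F p)"
proof -
  have "p \<in> tensor_class scale m p"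
    using assms by (simp add: mem_tensor_class)
  moreover have "tensor_class scale n (F q) = tensor_class scale n (F p)"
    if "q \<in> tensor_class scale m p" for q
    using that assms by (simp add: mem_tensor_class tensor_class_eq_iff tensor_cong_sym)
  ultimately show ?thesis
    by blast
qed

lemma UN_tensor_class2:
  assumes "p \<in> free_tuples l" "q \<in> free_tuples m"
    and "\<And>p q. p \<in> free_tuples l \<Longrightarrow> q \<in> free_tuples m \<Longrightarrow> F p q \<in> free_tuples n"
    and "\<And>p' q'. p' \<in> free_tuples l \<Longrightarrow> q' \<in> free_tuples m \<Longrightarrow>
      tensor_cong scale l p p' \<Longrightarrow> tensor_cong scale m q q' \<Longrightarrow> tensor_cong scale n (F p q) (F p' q')"
  shows "(\<Union>p\<in>tensor_class scale l p. \<Union>q\<in>tensor_class scale m q. tensor_class scale n (F p q))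
           = tensor_class scale n (F p q)"
proof -
  have "p \<in> tensor_class scale l p" "q \<in> tensor_class scale m q"
    using assms by (simp_all add: mem_tensor_class)
  moreover have "tensor_class scale n (F p' q') = tensor_class scale n (F p q)"
    if "p' \<in> tensor_class scale l p" "q' \<in> tensor_class scale m q" for p' q'
    using that assms by (simp add: mem_tensor_class tensor_class_eq_iff tensor_cong_sym)
  ultimately show ?thesis
    by blast
qed

lemma tensor_add_class:
  assumes "p \<in> free_tuples n" "q \<in> free_tuples n"
  shows "tensor_add scale n (tensor_class scale n p) (tensor_class scale n q)
           = tensor_class scale n (p + q)"
  unfolding tensor_add_def
  using assms by (intro UN_tensor_class2) (auto intro: free_tuples_add tensor_cong_add)

lemma tensor_scale_class:
  assumes "p \<in> free_tuples n"
  shows "tensor_scale scale n c (tensor_class scale n p) = tensor_class scale n (free_scale c p)"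
  unfolding tensor_scale_def
  using assms by (intro UN_tensor_class) (auto intro: free_tuples_scale tensor_cong_scale)

lemma (in scaled_ring) tensor_mult_class:
  assumes "p \<in> free_tuples n" "q \<in> free_tuples n"
  shows "tensor_mult scale n (tensor_class scale n p) (tensor_class scale n q)
           = tensor_class scale n (free_mult p q)"
  unfolding tensor_mult_def free_mult_def[symmetric]
  using assms by (intro UN_tensor_class2) (auto intro: free_mult_tuples tensor_cong_mult)

lemma tensor_outer_class:
  assumes "p \<in> free_tuples m" "q \<in> free_tuples n"
  shows "tensor_outer scale m n (tensor_class scale m p) (tensor_class scale n q)
           = tensor_class scale (m + n) (free_outer p q)"
  unfolding tensor_outer_def free_outer_def[symmetric]
  using assms by (intro UN_tensor_class2) (auto intro: free_outer_tuples tensor_cong_outer)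

text \<open>
  The representatives of the values of \<open>h\<close> picked by \<^const>\<open>tensor_lift\<close> are unknown, but congruent to
  the values of \<open>g\<close>, so that the lift may be computed with \<open>g\<close>.
\<close>

lemma tensor_lift_class:
  assumes "multilinear_mod scale m n g"
    and "\<And>xs. length xs = m \<Longrightarrow> g xs \<in> free_tuples n"
    and "\<And>xs. length xs = m \<Longrightarrow> h xs = tensor_class scale n (g xs)"
    and p: "p \<in> free_tuples m"
  shows "tensor_lift scale n h (tensor_class scale m p) = tensor_class scale n (free_extend g p)"
proof -
  let ?F = "free_extend (\<lambda>xs. tensor_rep (h xs))"
  have F: "?F q \<in> free_tuples n" and cong: "tensor_cong scale n (free_extend g q) (?F q)"
    if "q \<in> free_tuples m" for q
    using that assms(2,3)
    by (auto intro!: free_tuples_extend tensor_cong_extend tensor_rep_class)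
  have "tensor_cong scale n (?F p) (?F q)"
    if "q \<in> free_tuples m" "tensor_cong scale m p q" for q
    using cong[OF p] cong[OF that(1)] multilinear_mod_extend[OF assms(1) that(2)]
    by (meson tensor_cong_sym tensor_cong_trans)
  then have "tensor_lift scale n h (tensor_class scale m p) = tensor_class scale n (?F p)"
    unfolding tensor_lift_def tensor_rep_def[symmetric]
    using F p by (intro UN_tensor_class)
  also have "\<dots> = tensor_class scale n (free_extend g p)"
    using F[OF p] cong[OF p] assms(2) p
    by (simp add: tensor_class_eq_iff tensor_cong_sym free_tuples_extend)
  finally show ?thesis .
qed


section \<open>Places of tensor powers\<close>

text \<open>
  A permutation is given by the list \<open>\<pi>\<close> of its values, so that permuting the entries of \<open>xs\<close> is
  \<open>map ((!) xs) \<pi>\<close>. The medial map is the case \<open>\<pi> = [0, 2, 1, 3]\<close>.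
\<close>

definition permute_tensor ::
  "('k::field \<Rightarrow> 'b::ab_group_add \<Rightarrow> 'b) \<Rightarrow> nat \<Rightarrow> nat list \<Rightarrow> ('k, 'b) tensor \<Rightarrow> ('k, 'b) tensor" where
  "permute_tensor scale n \<pi> = tensor_lift scale n (\<lambda>xs. elementary scale (map ((!) xs) \<pi>))"

definition is_permutation :: "nat \<Rightarrow> nat list \<Rightarrow> bool" where
  "is_permutation n \<pi> \<longleftrightarrow> distinct \<pi> \<and> set \<pi> = {..<n}"

lemma is_permutation_length: "is_permutation n \<pi> \<Longrightarrow> length \<pi> = n"
  by (metis is_permutation_def distinct_card card_lessThan)

lemma is_permutation_less: "is_permutation n \<pi> \<Longrightarrow> k \<in> set \<pi> \<Longrightarrow> k < n"
  by (auto simp: is_permutation_def)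

lemma is_permutation_nth_eq_iff:
  "is_permutation n \<pi> \<Longrightarrow> k < n \<Longrightarrow> l < n \<Longrightarrow> \<pi> ! k = \<pi> ! l \<longleftrightarrow> k = l"
  using is_permutation_length[of n \<pi>] by (simp add: is_permutation_def nth_eq_iff_index_eq)

lemma multilinear_mod_permute:
  fixes scale :: "'k::field \<Rightarrow> 'b::ab_group_add \<Rightarrow> 'b"
  assumes "is_permutation n \<pi>"
  shows "multilinear_mod scale n n (\<lambda>xs. Poly_Mapping.single (map ((!) xs) \<pi>) 1)"
proof (rule multilinear_mod_single)
  fix xs :: "'b list" and i
  assume *: "length xs = n" "i < n"
  then have "i \<in> set \<pi>"
    using assms by (simp add: is_permutation_def)
  then obtain k where k: "k < n" "\<pi> ! k = i"
    unfolding in_set_conv_nth is_permutation_length[OF assms] by blast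
  have index: "\<pi> ! l = i \<longleftrightarrow> l = k" if "l < n" for l
    using is_permutation_nth_eq_iff[OF assms that k(1)] k(2) by simp
  have "map ((!) (xs[i := a])) \<pi> = (map ((!) xs) \<pi>)[k := a]" for a
    by (rule nth_equalityI)
       (use * k(1) index is_permutation_length[OF assms] in \<open>auto simp: nth_list_update\<close>)
  then show "\<exists>k L ws. k < n \<and> length ws = n \<and> (\<forall>a. map ((!) (xs[i := a])) \<pi> = ws[k := L a])
      \<and> (\<forall>a b. L (a + b) = L a + L b) \<and> (\<forall>c a. L (scale c a) = scale c (L a))"
    using k is_permutation_length[OF assms]
    by (intro exI[of _ k] exI[of _ "\<lambda>a. a"] exI[of _ "map ((!) xs) \<pi>"]) auto
qed

lemma permute_tensor_class:
  assumes "is_permutation n \<pi>" "p \<in> free_tuples n"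
  shows "permute_tensor scale n \<pi> (tensor_class scale n p)
           = tensor_class scale n (free_map (\<lambda>xs. map ((!) xs) \<pi>) p)"
  unfolding permute_tensor_def free_map_def
  using assms is_permutation_length[OF assms(1)]
  by (intro tensor_lift_class multilinear_mod_permute) (auto simp: elementary_def intro: free_tuples_single)

definition place_list :: "'b \<Rightarrow> nat \<Rightarrow> nat list \<Rightarrow> 'b list \<Rightarrow> 'b list" where
  "place_list e n is xs = map (\<lambda>j. case map_of (zip is xs) j of Some x \<Rightarrow> x | None \<Rightarrow> e) [1..<Suc n]"

lemma length_place_list [simp]: "length (place_list e n is xs) = n"
  by (simp add: place_list_def)

lemma map_of_zip_list_update:
  assumes "distinct ks" "length xs = length ks" "i < length ks"
  shows "map_of (zip ks (xs[i := a])) = (map_of (zip ks xs))(ks ! i \<mapsto> a)"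
  using assms
proof (induction ks arbitrary: xs i)
  case (Cons k ks)
  then obtain y ys where xs: "xs = y # ys" "length ys = length ks"
    by (cases xs) auto
  show ?case
  proof (cases i)
    case (Suc j)
    then have "ks ! j \<noteq> k"
      using Cons.prems by auto
    with Suc xs Cons show ?thesis
      by (auto simp: fun_upd_twist)
  qed (auto simp: xs)
qed simp

text \<open>
  As the places \<open>is\<close> are distinct and lie between 1 and \<open>n\<close>, the \<open>i\<close>-th entry of the argument occurs
  exactly once in the result, at the list position \<open>is ! i - 1\<close>.
\<close>

lemma multilinear_mod_place:
  fixes scale :: "'k::field \<Rightarrow> 'b::ab_group_add \<Rightarrow> 'b"
  assumes "distinct is" "set is \<subseteq> {1..n}" "length is = m"
  shows "multilinear_mod scale m n (\<lambda>xs. Poly_Mapping.single (place_list e n is xs) 1)"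
proof (rule multilinear_mod_single)
  fix xs :: "'b list" and i
  assume *: "length xs = m" "i < m"
  define k where "k = is ! i - 1"
  have "is ! i \<in> {1..n}"
    using * assms by (metis nth_mem subsetD)
  then have k: "k < n" "is ! i = Suc k"
    by (auto simp: k_def)
  have "map_of (zip is (xs[i := a])) = (map_of (zip is xs))(is ! i \<mapsto> a)" for a
    using assms(1,3) * by (intro map_of_zip_list_update) auto
  then have "place_list e n is (xs[i := a]) = (place_list e n is xs)[k := a]" for a
    using k by (auto simp: place_list_def list_eq_iff_nth_eq nth_list_update simp del: upt_Suc)
  then show "\<exists>k L ws. k < n \<and> length ws = n \<and> (\<forall>a. place_list e n is (xs[i := a]) = ws[k := L a])
      \<and> (\<forall>a b. L (a + b) = L a + L b) \<and> (\<forall>c a. L (scale c a) = scale c (L a))"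
    using k by (intro exI[of _ k] exI[of _ "\<lambda>a. a"] exI[of _ "place_list e n is xs"]) auto
qed

lemma extended_class:
  assumes "distinct is" "set is \<subseteq> {1..n}" "length is = m" "p \<in> free_tuples m"
  shows "extended scale e n is (tensor_class scale m p)
           = tensor_class scale n (free_map (place_list e n is) p)"
  unfolding extended_def free_map_def place_list_def[symmetric]
  using assms
  by (intro tensor_lift_class multilinear_mod_place) (auto simp: elementary_def intro: free_tuples_single)

lemma free_map_permute_mult:
  assumes "is_permutation n \<pi>" "p \<in> free_tuples n" "q \<in> free_tuples n"
  shows "free_map (\<lambda>xs. map ((!) xs) \<pi>) (free_mult p q)
           = free_mult (free_map (\<lambda>xs. map ((!) xs) \<pi>) p) (free_map (\<lambda>xs. map ((!) xs) \<pi>) q)"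
proof -
  have "map ((!) (map2 (*) xs ys)) \<pi> = map2 (*) (map ((!) xs) \<pi>) (map ((!) ys) \<pi>)"
    if "length xs = n" "length ys = n" for xs ys :: "'a list"
    using that is_permutation_less[OF assms(1)] by (intro nth_equalityI) auto
  then show ?thesis
    unfolding free_map_def free_mult_def
    by (auto simp: free_extend_compose intro!: free_extend_cong_tuples[OF assms(2)]
        free_extend_cong_tuples[OF assms(3)])
qed

lemma (in scaled_ring) tensor_mult_closed:
  assumes "S \<in> tensor_power scale n" "T \<in> tensor_power scale n"
  shows "tensor_mult scale n S T \<in> tensor_power scale n"
  using assms tensor_mult_class
  by (auto simp: tensor_power_iff intro: free_mult_tuples)

lemma (in scaled_ring) tensor_mult_assoc:
  assumes "R \<in> tensor_power scale n" "S \<in> tensor_power scale n" "T \<in> tensor_power scale n"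
  shows "tensor_mult scale n (tensor_mult scale n R S) T
           = tensor_mult scale n R (tensor_mult scale n S T)"
  using assms tensor_mult_class
  by (auto simp: tensor_power_iff free_mult_tuples free_mult_assoc)

lemma (in scaled_ring) permute_tensor_mult:
  assumes "is_permutation n \<pi>" "S \<in> tensor_power scale n" "T \<in> tensor_power scale n"
  shows "permute_tensor scale n \<pi> (tensor_mult scale n S T)
           = tensor_mult scale n (permute_tensor scale n \<pi> S) (permute_tensor scale n \<pi> T)"
proof -
  have "free_map (\<lambda>xs. map ((!) xs) \<pi>) p \<in> free_tuples n" if "p \<in> free_tuples n"
    for p :: "'b list \<Rightarrow>\<^sub>0 'k"
    using that is_permutation_length[OF assms(1)] by (intro free_map_tuples[of _ n]) auto
  then show ?thesis
    using assms tensor_mult_class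
    by (auto simp: tensor_power_iff free_mult_tuples permute_tensor_class free_map_permute_mult)
qed

lemma extended_closed:
  assumes "distinct is" "set is \<subseteq> {1..n}" "length is = m" "T \<in> tensor_power scale m"
  shows "extended scale e n is T \<in> tensor_power scale n"
  using assms by (auto simp: tensor_power_iff extended_class intro!: bexI[OF _ free_map_tuples[of _ m]])

text \<open>
  The permuted tensor has in place \<open>j\<close> what the given one has in place \<open>Suc (\<pi> ! (j - 1))\<close>, since
  places count from 1 and list positions from 0. So it is the extended list on the right of the
  equation that determines the one on the left.
\<close>

lemma permute_extended:
  fixes scale :: "'k::field \<Rightarrow> 'b::ab_group_add \<Rightarrow> 'b"
  assumes \<pi>: "is_permutation n \<pi>" and T: "T \<in> tensor_power scale m"
    and js: "distinct js" "set js \<subseteq> {1..n}" "length js = m"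
  shows "permute_tensor scale n \<pi> (extended scale e n (map (\<lambda>j. Suc (\<pi> ! (j - 1))) js) T)
           = extended scale e n js T"
proof -
  let ?f = "\<lambda>j. Suc (\<pi> ! (j - 1))"
  obtain p where p: "p \<in> free_tuples m" "T = tensor_class scale m p"
    using T by (auto simp: tensor_power_iff)
  have inj: "?f i = ?f j \<longleftrightarrow> i = j" if "i \<in> {1..n}" "j \<in> {1..n}" for i j
  proof -
    have "\<pi> ! (i - 1) = \<pi> ! (j - 1) \<longleftrightarrow> i - 1 = j - 1"
      using that by (intro is_permutation_nth_eq_iff[OF \<pi>]) auto
    then show ?thesis
      using that by auto
  qed
  have "inj_on ?f (set js)"
    using inj js(2) by (meson inj_onI subsetD)
  moreover have "?f j \<in> {1..n}" if "j \<in> {1..n}" for j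
    using that is_permutation_less[OF \<pi>, of "\<pi> ! (j - 1)"] is_permutation_length[OF \<pi>]
    by (auto simp: Suc_le_eq)
  ultimately have map_js: "distinct (map ?f js)" "set (map ?f js) \<subseteq> {1..n}" "length (map ?f js) = m"
    using js by (auto simp: distinct_map)
  have lookup: "map_of (zip (map ?f ls) xs) (Suc (\<pi> ! k)) = map_of (zip ls xs) (Suc k)"
    if "set ls \<subseteq> {1..n}" "k < n" for k ls and xs :: "'b list"
    using that(1)
  proof (induction ls arbitrary: xs)
    case (Cons l ls)
    then show ?case
      using inj[of "Suc k" l] \<open>k < n\<close> by (cases xs) auto
  qed simp
  have "map ((!) (place_list e n (map ?f js) xs)) \<pi> = place_list e n js xs" for xs :: "'b list"
    using lookup[OF js(2)] is_permutation_length[OF \<pi>] is_permutation_less[OF \<pi>]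
    by (intro nth_equalityI) (auto simp: place_list_def simp del: upt_Suc)
  then show ?thesis
    using \<pi> js map_js p by (simp add: extended_class permute_tensor_class free_map_tuples[of _ m])
      (simp add: free_map_def free_extend_compose)
qed


section \<open>Tensor products of linear maps\<close>

definition linear_to_tensor ::
  "('k::field \<Rightarrow> 'b::ab_group_add \<Rightarrow> 'b) \<Rightarrow> nat \<Rightarrow> ('b \<Rightarrow> ('k, 'b) tensor) \<Rightarrow> bool" where
  "linear_to_tensor scale n f \<longleftrightarrow> (\<forall>a. f a \<in> tensor_power scale n)
     \<and> (\<forall>a b. f (a + b) = tensor_add scale n (f a) (f b))
     \<and> (\<forall>c a. f (scale c a) = tensor_scale scale n c (f a))"

text \<open>
  Linearity of a tensor-valued map in terms of the chosen representatives, which themselves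
  depend on the argument linearly only up to congruence.
\<close>

lemma linear_to_tensor_iff:
  "linear_to_tensor scale n f \<longleftrightarrow> (\<forall>a. f a \<in> tensor_power scale n)
     \<and> (\<forall>a b. tensor_cong scale n (tensor_rep (f (a + b))) (tensor_rep (f a) + tensor_rep (f b)))
     \<and> (\<forall>c a. tensor_cong scale n (tensor_rep (f (scale c a))) (free_scale c (tensor_rep (f a))))"
proof (cases "\<forall>a. f a \<in> tensor_power scale n")
  case True
  have "f (a + b) = tensor_add scale n (f a) (f b)
    \<longleftrightarrow> tensor_cong scale n (tensor_rep (f (a + b))) (tensor_rep (f a) + tensor_rep (f b))" for a b
    using True
    by (metis free_tuples_add tensor_add_class tensor_class_eq_iff tensor_class_rep tensor_rep_tuples)
  moreover have "f (scale c a) = tensor_scale scale n c (f a)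
    \<longleftrightarrow> tensor_cong scale n (tensor_rep (f (scale c a))) (free_scale c (tensor_rep (f a)))" for c a
    using True
    by (metis free_tuples_scale tensor_scale_class tensor_class_eq_iff tensor_class_rep tensor_rep_tuples)
  ultimately show ?thesis
    by (simp add: linear_to_tensor_def)
qed (auto simp: linear_to_tensor_def)

text \<open>
  A representative of \<^const>\<open>tensor_concat\<close>. Entries of the list beyond the number of maps are
  ignored, which makes the decomposition of a concatenation of lists of maps simple.
\<close>

fun concat_rep :: "(nat \<times> ('b \<Rightarrow> ('k::field, 'b) tensor)) list \<Rightarrow> 'b list \<Rightarrow> ('b list \<Rightarrow>\<^sub>0 'k)" where
  "concat_rep [] xs = Poly_Mapping.single [] 1"
| "concat_rep ((d, f) # fs) xs = free_outer (tensor_rep (f (hd xs))) (concat_rep fs (tl xs))"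

lemma concat_rep_tuples:
  assumes "\<And>d f. (d, f) \<in> set fs \<Longrightarrow> linear_to_tensor scale d f"
  shows "concat_rep fs xs \<in> free_tuples (sum_list (map fst fs))"
  using assms
proof (induction fs arbitrary: xs)
  case (Cons df fs)
  then have "linear_to_tensor scale (fst df) (snd df)"
    by simp
  then have "tensor_rep (snd df (hd xs)) \<in> free_tuples (fst df)"
    by (auto simp: linear_to_tensor_def intro: tensor_rep_tuples)
  then show ?case
    using Cons by (cases df) (auto intro!: free_outer_tuples)
qed (simp add: free_tuples_single)

lemma tensor_concat_class:
  assumes "\<And>d f. (d, f) \<in> set fs \<Longrightarrow> linear_to_tensor scale d f" "length xs = length fs"
  shows "tensor_concat scale (map2 (\<lambda>(d, f) x. (d, f x)) fs xs)
           = tensor_class scale (sum_list (map fst fs)) (concat_rep fs xs)"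
  using assms
proof (induction fs arbitrary: xs)
  case (Cons df fs)
  obtain d f where df: "df = (d, f)"
    by (cases df)
  obtain y ys where xs: "xs = y # ys"
    using Cons.prems(2) by (cases xs) auto
  have "map fst (map2 (\<lambda>(d, f) x. (d, f x)) fs ys) = map fst fs"
    using Cons.prems(2) xs by (intro nth_equalityI) (auto split: prod.split)
  moreover have "f y \<in> tensor_power scale d"
    using Cons.prems(1)[of d f] df by (auto simp: linear_to_tensor_def)
  moreover have "concat_rep fs ys \<in> free_tuples (sum_list (map fst fs))"
    using Cons.prems(1) by (intro concat_rep_tuples[of _ scale]) auto
  ultimately show ?case
    using Cons df xs
    by (simp add: tensor_outer_class tensor_rep_tuples tensor_class_rep flip: tensor_outer_class)
qed (simp add: elementary_def)

lemma free_outer_add_left: "free_outer (p + p') q = free_outer p q + free_outer p' q"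
  by (simp add: free_outer_def free_extend_add)

lemma free_outer_scale_left: "free_outer (free_scale c p) q = free_scale c (free_outer p q)"
  by (simp add: free_outer_def free_extend_scale)

lemma free_outer_eq_swapped:
  "free_outer p q = free_extend (\<lambda>ys. free_extend (\<lambda>xs. Poly_Mapping.single (xs @ ys) 1) p) q"
  unfolding free_outer_def by (rule free_extend_swap)

lemma free_outer_add_right: "free_outer p (q + q') = free_outer p q + free_outer p q'"
  by (simp add: free_outer_eq_swapped free_extend_add)

lemma free_outer_scale_right: "free_outer p (free_scale c q) = free_scale c (free_outer p q)"
  by (simp add: free_outer_eq_swapped free_extend_scale)

lemma multilinear_mod_concat_rep:
  fixes scale :: "'k::field \<Rightarrow> 'b::ab_group_add \<Rightarrow> 'b"
  assumes "\<And>d f. (d, f) \<in> set fs \<Longrightarrow> linear_to_tensor scale d f"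
  shows "multilinear_mod scale (length fs) (sum_list (map fst fs)) (concat_rep fs)"
  using assms
proof (induction fs)
  case (Cons df fs)
  obtain d f where df: "df = (d, f)"
    by (cases df)
  have f: "linear_to_tensor scale d f"
    using Cons.prems df by simp
  have rep: "tensor_rep (f y) \<in> free_tuples d" for y
    using f by (auto simp: linear_to_tensor_def intro: tensor_rep_tuples)
  have tuples: "concat_rep fs ys \<in> free_tuples (sum_list (map fst fs))" for ys
    using Cons.prems by (intro concat_rep_tuples[of _ scale]) auto
  have ml: "multilinear_mod scale (length fs) (sum_list (map fst fs)) (concat_rep fs)"
    using Cons by auto
  show ?case
    unfolding multilinear_mod_def
  proof (intro allI impI)
    fix xs :: "'b list" and i a b c
    assume *: "length xs = length (df # fs)" "i < length (df # fs)"
    then obtain y ys where xs: "xs = y # ys" "length ys = length fs"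
      by (cases xs) auto
    let ?N = "sum_list (map fst (df # fs))"
    show "tensor_cong scale ?N (concat_rep (df # fs) (xs[i := a + b]))
        (concat_rep (df # fs) (xs[i := a]) + concat_rep (df # fs) (xs[i := b]))
      \<and> tensor_cong scale ?N (concat_rep (df # fs) (xs[i := scale c a]))
        (free_scale c (concat_rep (df # fs) (xs[i := a])))"
    proof (cases i)
      case 0
      then show ?thesis
        using f rep tuples
        by (auto simp: df xs linear_to_tensor_iff simp flip: free_outer_add_left free_outer_scale_left
            intro!: tensor_cong_outer)
    next
      case (Suc j)
      then have "j < length fs"
        using * by simp
      then show ?thesis
        using Suc ml xs(2) rep tuples
        by (auto simp: df xs(1) multilinear_mod_def simp flip: free_outer_add_right free_outer_scale_right
            intro!: tensor_cong_outer free_tuples_add free_tuples_scale)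
    qed
  qed
qed (simp add: multilinear_mod_def)

lemma tensor_of_maps_class:
  assumes "\<And>d f. (d, f) \<in> set fs \<Longrightarrow> linear_to_tensor scale d f"
    and "p \<in> free_tuples (length fs)"
  shows "tensor_of_maps scale fs (tensor_class scale (length fs) p)
           = tensor_class scale (sum_list (map fst fs)) (free_extend (concat_rep fs) p)"
  unfolding tensor_of_maps_def
  using assms
  by (intro tensor_lift_class multilinear_mod_concat_rep tensor_concat_class concat_rep_tuples) auto

lemma linear_to_tensor_ident: "linear_to_tensor scale (fst (ident scale)) (snd (ident scale))"
proof -
  have "tensor_cong scale 1 (Poly_Mapping.single [a + b] 1)
      (Poly_Mapping.single [a] 1 + Poly_Mapping.single [b] 1)"
    and "tensor_cong scale 1 (Poly_Mapping.single [scale c a] 1)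
      (free_scale c (Poly_Mapping.single [a] 1))" for a b c
    using multilinear_mod_append_left[of "[]" 0 scale 1, unfolded multilinear_mod_def,
        rule_format, of "[0]" 0 a b c] by auto
  then show ?thesis
    by (auto simp: linear_to_tensor_def ident_def elementary_def tensor_add_class tensor_scale_class
        tensor_class_eq_iff free_tuples_single free_tuples_add free_tuples_scale
        intro!: tensor_class_in_power)
qed

text \<open>
  Although the values of a lift depend on chosen representatives, they are linear in the lifted
  tensor. This makes \<open>(\<Delta> \<otimes> \<Delta>) \<circ> \<Delta>\<close> itself a linear map that can be a factor of a tensor product.
\<close>

lemma linear_to_tensor_compose:
  assumes f: "linear_to_tensor scale (length fs) f"
    and fs: "\<And>d f. (d, f) \<in> set fs \<Longrightarrow> linear_to_tensor scale d f"
  shows "linear_to_tensor scale (sum_list (map fst fs)) (\<lambda>b. tensor_of_maps scale fs (f b))"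
proof -
  let ?F = "\<lambda>p. free_extend (concat_rep fs) p"
  have rep: "tensor_rep (f b) \<in> free_tuples (length fs)"
    and "f b = tensor_class scale (length fs) (tensor_rep (f b))" for b
    using f by (simp_all add: linear_to_tensor_def tensor_rep_tuples[of _ scale] tensor_class_rep)
  then have eq: "tensor_of_maps scale fs (f b)
      = tensor_class scale (sum_list (map fst fs)) (?F (tensor_rep (f b)))" for b
    using tensor_of_maps_class[OF fs, where p = "tensor_rep (f b)"] by metis
  have tuples: "?F (tensor_rep (f b)) \<in> free_tuples (sum_list (map fst fs))" for b
    using rep concat_rep_tuples[OF fs] by (intro free_tuples_extend[of _ "length fs"]) auto
  have class_eq: "tensor_class scale (sum_list (map fst fs)) (?F p)
      = tensor_class scale (sum_list (map fst fs)) (?F q)"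
    if "p \<in> free_tuples (length fs)" "q \<in> free_tuples (length fs)"
      "tensor_cong scale (length fs) p q" for p q
  proof -
    have "?F p \<in> free_tuples (sum_list (map fst fs))" "?F q \<in> free_tuples (sum_list (map fst fs))"
      using that(1,2) concat_rep_tuples[OF fs] by (auto intro: free_tuples_extend)
    then show ?thesis
      using multilinear_mod_extend[OF multilinear_mod_concat_rep[OF fs] that(3)]
      by (simp add: tensor_class_eq_iff)
  qed
  show ?thesis
    unfolding linear_to_tensor_def eq
    using f[unfolded linear_to_tensor_iff]
    unfolding tensor_add_class[OF tuples tuples] tensor_scale_class[OF tuples]
      free_extend_add[symmetric] free_extend_scale[symmetric]
    by (intro conjI allI class_eq tensor_class_in_power tuples free_tuples_add free_tuples_scale rep)
       simp_all
qed


section \<open>Moving an intertwiner past a tensor product of maps\<close>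

text \<open>
  The interchange law \<open>(p \<otimes> q) \<cdot> (p' \<otimes> q') = (p \<cdot> p') \<otimes> (q \<cdot> q')\<close>. The lengths in the first block have
  to agree, since otherwise the componentwise product would mix the blocks.
\<close>

lemma free_mult_outer:
  assumes "p \<in> free_tuples m" "p' \<in> free_tuples m"
  shows "free_mult (free_outer p q) (free_outer p' q') = free_outer (free_mult p p') (free_mult q q')"
proof -
  have "free_mult (free_outer p q) (free_outer p' q')
      = free_extend (\<lambda>xs. free_extend (\<lambda>ys. free_extend (\<lambda>xs'. free_extend
          (\<lambda>ys'. Poly_Mapping.single (map2 (*) (xs @ ys) (xs' @ ys')) 1) q') p') q) p"
    by (simp add: free_mult_def free_outer_def free_extend_compose)
  also have "\<dots> = free_extend (\<lambda>xs. free_extend (\<lambda>xs'. free_extend (\<lambda>ys. free_extend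
          (\<lambda>ys'. Poly_Mapping.single (map2 (*) (xs @ ys) (xs' @ ys')) 1) q') q) p') p"
    by (simp add: free_extend_swap[of _ p' q])
  also have "\<dots> = free_extend (\<lambda>xs. free_extend (\<lambda>xs'. free_extend (\<lambda>ys. free_extend
          (\<lambda>ys'. Poly_Mapping.single (map2 (*) xs xs' @ map2 (*) ys ys') 1) q') q) p') p"
    using assms(2)
    by (intro free_extend_cong_tuples[OF assms(1)] free_extend_cong_tuples[OF assms(2)] free_extend_cong)
       simp
  also have "\<dots> = free_outer (free_mult p p') (free_mult q q')"
    by (simp add: free_mult_def free_outer_def free_extend_compose)
  finally show ?thesis .
qed

lemma free_mult_units_left:
  assumes "\<And>b. e * b = b" "p \<in> free_tuples n"
  shows "free_mult (Poly_Mapping.single (replicate n e) 1) p = p"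
proof -
  have "map2 (*) (replicate n e) xs = xs" if "length xs = n" for xs
    using that assms(1) by (intro nth_equalityI) auto
  then have "free_mult (Poly_Mapping.single (replicate n e) 1) p
      = free_extend (\<lambda>x. Poly_Mapping.single x 1) p"
    using assms(2) by (auto simp: free_mult_def intro!: free_extend_cong_tuples)
  then show ?thesis
    by (simp add: free_extend_basis)
qed

lemma free_mult_units_right:
  assumes "\<And>b. b * e = b" "p \<in> free_tuples n"
  shows "free_mult p (Poly_Mapping.single (replicate n e) 1) = p"
proof -
  have "map2 (*) xs (replicate n e) = xs" if "length xs = n" for xs
    using that assms(1) by (intro nth_equalityI) auto
  then have "free_mult p (Poly_Mapping.single (replicate n e) 1)
      = free_extend (\<lambda>x. Poly_Mapping.single x 1) p"
    using assms(2) by (auto simp: free_mult_def intro!: free_extend_cong_tuples)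
  then show ?thesis
    by (simp add: free_extend_basis)
qed

text \<open>
  The permutation \<open>\<pi>\<close> acting on a block of places that is preceded by \<open>j\<close> and followed by \<open>k\<close>
  fixed places.
\<close>

definition pad_permutation :: "nat \<Rightarrow> nat \<Rightarrow> nat list \<Rightarrow> nat list" where
  "pad_permutation j k \<pi> = [0..<j] @ map ((+) j) \<pi> @ [j + length \<pi>..<j + length \<pi> + k]"

lemma is_permutation_pad:
  assumes "is_permutation n \<pi>"
  shows "is_permutation (j + n + k) (pad_permutation j k \<pi>)"
proof -
  have "(+) j ` {..<n} = {j..<j + n}"
    by (simp add: lessThan_atLeast0 add.commute)
  then show ?thesis
    using assms is_permutation_length[OF assms]
    by (auto simp: is_permutation_def pad_permutation_def distinct_map)
qed

lemma free_map_pad_permutation: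
  assumes "is_permutation n \<pi>" "v \<in> free_tuples j" "u \<in> free_tuples n" "w \<in> free_tuples k"
  shows "free_map (\<lambda>xs. map ((!) xs) (pad_permutation j k \<pi>)) (free_outer v (free_outer u w))
           = free_outer v (free_outer (free_map (\<lambda>xs. map ((!) xs) \<pi>) u) w)"
proof -
  have "map ((!) (vs @ us @ ws)) (pad_permutation j k \<pi>) = vs @ map ((!) us) \<pi> @ ws"
    if "length vs = j" "length us = n" "length ws = k" for vs us ws :: "'a list"
  proof -
    have "map ((!) (vs @ us @ ws)) [0..<j] = vs"
      using that by (intro nth_equalityI) (auto simp: nth_append)
    moreover have "map ((!) (vs @ us @ ws)) (map ((+) j) \<pi>) = map ((!) us) \<pi>"
      using that is_permutation_less[OF assms(1)] by (auto simp: nth_append)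
    moreover have "map ((!) (vs @ us @ ws)) [j + n..<j + n + k] = ws"
      using that by (intro nth_equalityI) (auto simp: nth_append)
    ultimately show ?thesis
      by (simp add: pad_permutation_def is_permutation_length[OF assms(1)])
  qed
  then show ?thesis
    by (simp add: free_map_def free_outer_def free_extend_compose)
       (intro free_extend_cong_tuples[OF assms(2)] free_extend_cong_tuples[OF assms(3)]
          free_extend_cong_tuples[OF assms(4)]; simp)
qed

lemma place_list_interval:
  assumes "length xs = n"
  shows "place_list e (j + n + k) [Suc j..<Suc (j + n)] xs = replicate j e @ xs @ replicate k e"
proof (rule nth_equalityI)
  fix i
  assume "i < length (place_list e (j + n + k) [Suc j..<Suc (j + n)] xs)"
  then have i: "i < j + n + k"
    by simp
  let ?m = "map_of (zip [Suc j..<Suc (j + n)] xs) (Suc i)"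
  have "?m = (if j \<le> i \<and> i < j + n then Some (xs ! (i - j)) else None)"
  proof (cases "j \<le> i \<and> i < j + n")
    case True
    then have "[Suc j..<Suc (j + n)] ! (i - j) = Suc i"
      by (simp add: nth_upt del: upt_Suc)
    moreover have "map_of (zip [Suc j..<Suc (j + n)] xs) ([Suc j..<Suc (j + n)] ! (i - j))
        = Some (xs ! (i - j))"
      using True assms by (intro map_of_zip_nth) auto
    ultimately show ?thesis
      using True by simp
  qed (use assms in \<open>auto simp: map_of_zip_is_None simp del: upt_Suc\<close>)
  with i assms show "place_list e (j + n + k) [Suc j..<Suc (j + n)] xs ! i
      = (replicate j e @ xs @ replicate k e) ! i"
    by (auto simp: place_list_def nth_append simp del: upt_Suc)
qed (simp add: assms)

text \<open>
  The extended element \<open>E\<close> is \<open>e \<otimes> \<dots> \<otimes> e \<otimes> p \<otimes> e \<otimes> \<dots> \<otimes> e\<close>. By the interchange law, multiplying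
  \<open>v \<otimes> u \<otimes> w\<close> by \<open>E\<close> on either side multiplies only the middle block, by \<open>p\<close> on the same side.
\<close>

lemma (in scaled_ring) tensor_cong_exchange:
  assumes e: "\<And>b. e * b = b" "\<And>b. b * e = b"
    and \<pi>: "is_permutation n \<pi>"
    and tuples: "v \<in> free_tuples j" "u \<in> free_tuples n" "w \<in> free_tuples k" "p \<in> free_tuples n"
    and cong: "tensor_cong scale n (free_mult (free_map (\<lambda>xs. map ((!) xs) \<pi>) u) p) (free_mult p u)"
  defines "E \<equiv> free_map (place_list e (j + n + k) [Suc j..<Suc (j + n)]) p"
    and "D \<equiv> free_outer v (free_outer u w)"
  shows "tensor_cong scale (j + n + k) (free_mult E D)
           (free_mult (free_map (\<lambda>xs. map ((!) xs) (pad_permutation j k \<pi>)) D) E)"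
proof -
  let ?u = "free_map (\<lambda>xs. map ((!) xs) \<pi>) u"
  have u: "?u \<in> free_tuples n"
    using tuples(2) is_permutation_length[OF \<pi>] by (intro free_map_tuples[of _ n]) auto
  have units: "Poly_Mapping.single (replicate i e) (1 :: 'k) \<in> free_tuples i" for i
    by (simp add: free_tuples_single)
  have "E = free_map (\<lambda>xs. replicate j e @ xs @ replicate k e) p"
    unfolding E_def free_map_def
    by (intro free_extend_cong_tuples[OF tuples(4)]) (simp only: place_list_interval)
  then have E: "E = free_outer (Poly_Mapping.single (replicate j e) 1)
      (free_outer p (Poly_Mapping.single (replicate k e) 1))"
    by (simp add: free_map_def free_outer_def free_extend_compose)
  have "free_mult E D = free_outer v (free_outer (free_mult p u) w)"
    using tuples units e by (simp add: E D_def free_mult_outer[of _ j] free_mult_outer[of _ n] free_mult_units_left)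
  moreover have "free_mult (free_map (\<lambda>xs. map ((!) xs) (pad_permutation j k \<pi>)) D) E
      = free_outer v (free_outer (free_mult ?u p) w)"
    using tuples u units e
    by (simp add: E D_def free_map_pad_permutation[OF \<pi>] free_mult_outer[of _ j]
        free_mult_outer[of _ n] free_mult_units_right)
  moreover have "tensor_cong scale (j + (n + k)) (free_outer v (free_outer (free_mult p u) w))
      (free_outer v (free_outer (free_mult ?u p) w))"
    using tuples u tensor_cong_sym[OF cong]
    by (intro tensor_cong_outer tensor_cong_refl free_outer_tuples free_mult_tuples)
  ultimately show ?thesis
    by (simp add: add.assoc)
qed

lemma concat_rep_append:
  "concat_rep (fs @ gs) xs = free_outer (concat_rep fs xs) (concat_rep gs (drop (length fs) xs))"
  by (induction fs xs rule: concat_rep.induct)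
     (auto simp: free_outer_Nil free_outer_assoc drop_Suc)

lemma free_mult_extend_left: "free_mult (free_extend h p) q = free_extend (\<lambda>x. free_mult (h x) q) p"
  by (simp add: free_mult_def free_extend_compose)

lemma free_mult_extend_right: "free_mult q (free_extend h p) = free_extend (\<lambda>x. free_mult q (h x)) p"
  unfolding free_mult_def free_extend_compose by (rule free_extend_swap)

text \<open>
  If \<open>N\<close> intertwines \<open>f\<close> with its permuted version, then the extension of \<open>N\<close> to the places where \<open>f\<close>
  takes its values intertwines every tensor product of maps that contains \<open>f\<close> at these places.
  The value of such a product is a linear combination of tensors \<open>v \<otimes> f b \<otimes> w\<close>, and both sides
  are linear in it, so the exchange can be made in each summand.
\<close>

lemma (in scaled_ring) tensor_of_maps_exchange:
  fixes gs hs :: "(nat \<times> ('b \<Rightarrow> ('k, 'b) tensor)) list"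
  assumes e: "\<And>b. e * b = b" "\<And>b. b * e = b"
    and \<pi>: "is_permutation n \<pi>"
    and lin: "\<And>d g. (d, g) \<in> set (gs @ (n, f) # hs) \<Longrightarrow> linear_to_tensor scale d g"
    and N: "N \<in> tensor_power scale n"
    and T: "T \<in> tensor_power scale (length (gs @ (n, f) # hs))"
    and inter: "\<And>b. tensor_mult scale n (permute_tensor scale n \<pi> (f b)) N = tensor_mult scale n N (f b)"
    and j: "j = sum_list (map fst gs)" and k: "k = sum_list (map fst hs)"
  defines "E \<equiv> extended scale e (j + n + k) [Suc j..<Suc (j + n)] N"
    and "D \<equiv> tensor_of_maps scale (gs @ (n, f) # hs) T"
  shows "tensor_mult scale (j + n + k) E D
           = tensor_mult scale (j + n + k) (permute_tensor scale (j + n + k) (pad_permutation j k \<pi>) D) E"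
proof -
  let ?fs = "gs @ (n, f) # hs" and ?N = "j + n + k"
  let ?perm = "\<lambda>xs. map ((!) xs) (pad_permutation j k \<pi>)"
  obtain p where p: "p \<in> free_tuples n" "N = tensor_class scale n p"
    using N by (auto simp: tensor_power_iff)
  obtain t where t: "t \<in> free_tuples (length ?fs)" "T = tensor_class scale (length ?fs) t"
    using T by (auto simp: tensor_power_iff)
  have perm: "is_permutation ?N (pad_permutation j k \<pi>)"
    by (rule is_permutation_pad[OF \<pi>])
  let ?E = "free_map (place_list e ?N [Suc j..<Suc (j + n)]) p"
  let ?D = "free_extend (concat_rep ?fs) t"
  have concat: "concat_rep ?fs xs \<in> free_tuples ?N" for xs
    using concat_rep_tuples[of ?fs scale, OF lin] by (simp add: j k add.assoc)
  have tuples: "?E \<in> free_tuples ?N" "?D \<in> free_tuples ?N" "free_map ?perm ?D \<in> free_tuples ?N"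
  proof -
    show "?E \<in> free_tuples ?N"
      using p(1) by (rule free_map_tuples) simp
    show "?D \<in> free_tuples ?N"
      using t(1) concat by (rule free_tuples_extend)
    then show "free_map ?perm ?D \<in> free_tuples ?N"
      by (rule free_map_tuples) (simp add: is_permutation_length[OF perm])
  qed
  have E: "E = tensor_class scale ?N ?E"
    unfolding E_def p(2) using p(1) by (intro extended_class) auto
  have D: "D = tensor_class scale ?N ?D"
    unfolding D_def t(2) using tensor_of_maps_class[OF lin t(1)] by (simp add: j k add.assoc)
  have exchange: "tensor_cong scale ?N (free_mult ?E (concat_rep ?fs xs))
      (free_mult (free_map ?perm (concat_rep ?fs xs)) ?E)" for xs
  proof -
    define b where "b = hd (drop (length gs) xs)"
    have fb: "f b \<in> tensor_power scale n"
      using lin[of n f] by (simp add: linear_to_tensor_def)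
    let ?u = "tensor_rep (f b)"
    have u: "?u \<in> free_tuples n" "f b = tensor_class scale n ?u"
      using tensor_rep_tuples[OF fb] tensor_class_rep[OF fb] by auto
    have u': "free_map (\<lambda>xs. map ((!) xs) \<pi>) ?u \<in> free_tuples n"
      using u(1) by (rule free_map_tuples) (simp add: is_permutation_length[OF \<pi>])
    have "tensor_class scale n (free_mult (free_map (\<lambda>xs. map ((!) xs) \<pi>) ?u) p)
        = tensor_class scale n (free_mult p ?u)"
      using inter[of b] p u(1) u' \<pi>
      by (subst (asm) (1 2) u(2)) (simp add: permute_tensor_class tensor_mult_class)
    then have "tensor_cong scale n (free_mult (free_map (\<lambda>xs. map ((!) xs) \<pi>) ?u) p) (free_mult p ?u)"
      using p u(1) u' by (simp add: tensor_class_eq_iff free_mult_tuples)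
    moreover have "concat_rep gs xs \<in> free_tuples j" "concat_rep hs ys \<in> free_tuples k" for ys
      unfolding j k by (rule concat_rep_tuples[of _ scale]; simp add: lin)+
    ultimately show ?thesis
      using e \<pi> p(1) u(1) by (simp add: concat_rep_append b_def[symmetric] tensor_cong_exchange del: upt_Suc)
  qed
  have "tensor_cong scale ?N (free_mult ?E ?D) (free_mult (free_map ?perm ?D) ?E)"
    using tensor_cong_extend[OF t(1) exchange]
    by (simp add: free_mult_extend_left free_mult_extend_right free_map_def[of ?perm] free_extend_compose)
  then show ?thesis
    unfolding E D using tuples perm
    by (simp add: permute_tensor_class tensor_mult_class tensor_class_eq_iff free_mult_tuples)
qed

theorem proposition7p37:
  fixes scale :: "'k::field \<Rightarrow> 'b::ring \<Rightarrow> 'b"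
    and \<Delta> :: "'b \<Rightarrow> ('k, 'b) tensor"
    and e :: 'b
    and M :: "('k, 'b) tensor"
    and mult4 :: "('k, 'b) tensor \<Rightarrow> ('k, 'b) tensor \<Rightarrow> ('k, 'b) tensor" (infixl "\<cdot>\<^sub>4" 70)
    and mult7 :: "('k, 'b) tensor \<Rightarrow> ('k, 'b) tensor \<Rightarrow> ('k, 'b) tensor" (infixl "\<cdot>\<^sub>7" 70)
    and \<M> :: "nat \<Rightarrow> nat \<Rightarrow> nat \<Rightarrow> nat \<Rightarrow> ('k, 'b) tensor"
  defines "mult4 \<equiv> tensor_mult scale 4"
    and "mult7 \<equiv> tensor_mult scale 7"
    and "\<M> \<equiv> \<lambda>i\<^sub>1 i\<^sub>2 i\<^sub>3 i\<^sub>4. extended scale e 7 [i\<^sub>1, i\<^sub>2, i\<^sub>3, i\<^sub>4] M"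
  assumes "binary_bialgebra scale \<Delta>"
    and "\<And>b. e * b = b" and "\<And>b. b * e = b"
    and "M \<in> tensor_power scale 4"
    and "\<And>b. medial scale (comult4 scale \<Delta> b) \<cdot>\<^sub>4 M = M \<cdot>\<^sub>4 comult4 scale \<Delta> b"
    and "tensor_of_maps scale [(4, comult4 scale \<Delta>), ident scale, ident scale, ident scale] M
          = \<M> 1 5 6 7 \<cdot>\<^sub>7 \<M> 2 5 6 7 \<cdot>\<^sub>7 \<M> 3 5 6 7 \<cdot>\<^sub>7 \<M> 4 5 6 7"
    and "tensor_of_maps scale [ident scale, ident scale, ident scale, (4, comult4 scale \<Delta>)] M
          = \<M> 1 2 3 4 \<cdot>\<^sub>7 \<M> 1 2 3 6 \<cdot>\<^sub>7 \<M> 1 2 3 5 \<cdot>\<^sub>7 \<M> 1 2 3 7"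
  shows "(\<M> 1 2 3 4 \<cdot>\<^sub>7 \<M> 1 5 6 7 \<cdot>\<^sub>7 \<M> 2 5 6 7 \<cdot>\<^sub>7 \<M> 3 5 6 7 \<cdot>\<^sub>7 \<M> 4 5 6 7
          = \<M> 1 5 6 7 \<cdot>\<^sub>7 \<M> 3 5 6 7 \<cdot>\<^sub>7 \<M> 2 5 6 7 \<cdot>\<^sub>7 \<M> 4 5 6 7 \<cdot>\<^sub>7 \<M> 1 2 3 4)
      \<and> (\<M> 4 5 6 7 \<cdot>\<^sub>7 \<M> 1 2 3 4 \<cdot>\<^sub>7 \<M> 1 2 3 6 \<cdot>\<^sub>7 \<M> 1 2 3 5 \<cdot>\<^sub>7 \<M> 1 2 3 7
          = \<M> 1 2 3 4 \<cdot>\<^sub>7 \<M> 1 2 3 5 \<cdot>\<^sub>7 \<M> 1 2 3 6 \<cdot>\<^sub>7 \<M> 1 2 3 7 \<cdot>\<^sub>7 \<M> 4 5 6 7)"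
proof -
  interpret binary_bialgebra scale \<Delta>
    by fact
  interpret scaled_ring scale
    by unfold_locales (fact scale_mult_left scale_mult_right)+
  let ?\<pi> = "[0, 2, 1, 3] :: nat list"
  let ?f = "(4, comult4 scale \<Delta>)" and ?id = "ident scale"
  have \<pi>: "is_permutation 4 ?\<pi>"
    by (auto simp: is_permutation_def)
  have "linear_to_tensor scale 2 \<Delta>"
    by (simp add: linear_to_tensor_def comult_closed comult_add comult_scale)
  then have "linear_to_tensor scale 4 (comult4 scale \<Delta>)"
    using linear_to_tensor_compose[of scale "[(2, \<Delta>), (2, \<Delta>)]" \<Delta>]
    by (simp add: comult4_def[abs_def])
  then have lin: "linear_to_tensor scale d f"
    if "(d, f) \<in> {?f, ?id}" for d f
    using that linear_to_tensor_ident[of scale] by (metis fst_conv snd_conv empty_iff insert_iff)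
  have "medial scale = permute_tensor scale 4 ?\<pi>"
    by (simp add: medial_def permute_tensor_def)
  then have inter: "tensor_mult scale 4 (permute_tensor scale 4 ?\<pi> (comult4 scale \<Delta> b)) M
      = tensor_mult scale 4 M (comult4 scale \<Delta> b)" for b
    using assms(8)[of b] by (simp add: mult4_def)
  have [simp]: "fst ?id = 1"
    by (simp add: ident_def)
  have closed7: "S \<cdot>\<^sub>7 T \<in> tensor_power scale 7"
    if "S \<in> tensor_power scale 7" "T \<in> tensor_power scale 7" for S T
    using that by (simp add: mult7_def tensor_mult_closed)
  have assoc: "R \<cdot>\<^sub>7 (S \<cdot>\<^sub>7 T) = R \<cdot>\<^sub>7 S \<cdot>\<^sub>7 T"
    if "R \<in> tensor_power scale 7" "S \<in> tensor_power scale 7" "T \<in> tensor_power scale 7" for R S T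
    using that by (simp add: mult7_def tensor_mult_assoc)
  have \<M>: "\<M> i\<^sub>1 i\<^sub>2 i\<^sub>3 i\<^sub>4 \<in> tensor_power scale 7"
    if "distinct [i\<^sub>1, i\<^sub>2, i\<^sub>3, i\<^sub>4]" "{i\<^sub>1, i\<^sub>2, i\<^sub>3, i\<^sub>4} \<subseteq> {1..7}" for i\<^sub>1 i\<^sub>2 i\<^sub>3 i\<^sub>4
    unfolding \<M>_def using that assms(7) by (intro extended_closed[where m = 4]) auto
  have perm_mult: "permute_tensor scale 7 \<rho> (S \<cdot>\<^sub>7 T) = permute_tensor scale 7 \<rho> S \<cdot>\<^sub>7 permute_tensor scale 7 \<rho> T"
    if "is_permutation 7 \<rho>" "S \<in> tensor_power scale 7" "T \<in> tensor_power scale 7" for \<rho> S T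
    using that by (simp add: mult7_def permute_tensor_mult)
  have perm_\<M>: "permute_tensor scale 7 \<pi> (\<M> i\<^sub>1 i\<^sub>2 i\<^sub>3 i\<^sub>4) = \<M> j\<^sub>1 j\<^sub>2 j\<^sub>3 j\<^sub>4"
    if "is_permutation 7 \<pi>" "distinct [j\<^sub>1, j\<^sub>2, j\<^sub>3, j\<^sub>4]" "{j\<^sub>1, j\<^sub>2, j\<^sub>3, j\<^sub>4} \<subseteq> {1..7}"
      "[i\<^sub>1, i\<^sub>2, i\<^sub>3, i\<^sub>4] = map (\<lambda>j. Suc (\<pi> ! (j - 1))) [j\<^sub>1, j\<^sub>2, j\<^sub>3, j\<^sub>4]"
    for \<pi> i\<^sub>1 i\<^sub>2 i\<^sub>3 i\<^sub>4 j\<^sub>1 j\<^sub>2 j\<^sub>3 j\<^sub>4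
    unfolding \<M>_def that(4) using that(1-3) assms(7) by (intro permute_extended[where m = 4]) auto
  \<comment> \<open>The exchanges of the places 2, 3 and of the places 5, 6, as lists of positions from 0.\<close>
  define \<rho> where "\<rho> = [0, 2, 1, 3, 4, 5, 6 :: nat]"
  define \<sigma> where "\<sigma> = [0, 1, 2, 3, 5, 4, 6 :: nat]"
  have \<rho>: "pad_permutation 0 3 ?\<pi> = \<rho>" and \<sigma>: "pad_permutation 3 0 ?\<pi> = \<sigma>"
    by (simp_all add: pad_permutation_def \<rho>_def \<sigma>_def upt_rec)
  have perm: "is_permutation 7 \<rho>" "is_permutation 7 \<sigma>"
    using is_permutation_pad[OF \<pi>, of 0 3] is_permutation_pad[OF \<pi>, of 3 0] unfolding \<rho> \<sigma> by simp_all
  have places: "[Suc 0..<Suc (0 + 4)] = [1, 2, 3, 4]" "[Suc 3..<Suc (3 + 4)] = [4, 5, 6, 7]"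
    by (simp_all add: upt_rec)
  \<comment> \<open>\<open>(j, k) = (0, 3)\<close> and \<open>(3, 0)\<close> are the left sides of the two quasipolyangularity relations.\<close>
  have exchange: "tensor_mult scale (j + 4 + k) (extended scale e (j + 4 + k) [Suc j..<Suc (j + 4)] M)
        (tensor_of_maps scale (replicate j ?id @ ?f # replicate k ?id) M)
      = tensor_mult scale (j + 4 + k)
        (permute_tensor scale (j + 4 + k) (pad_permutation j k ?\<pi>)
          (tensor_of_maps scale (replicate j ?id @ ?f # replicate k ?id) M))
        (extended scale e (j + 4 + k) [Suc j..<Suc (j + 4)] M)"
    if "j + k = 3" for j k
  proof (rule tensor_of_maps_exchange[OF assms(5,6) \<pi>])
    show "M \<in> tensor_power scale (length (replicate j ?id @ ?f # replicate k ?id))"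
      using assms(7) that by simp
  qed (use lin inter assms(7) in \<open>auto simp: sum_list_replicate split: if_splits\<close>)
  have "\<M> 1 2 3 4 \<cdot>\<^sub>7 tensor_of_maps scale [?f, ?id, ?id, ?id] M
      = permute_tensor scale 7 \<rho> (tensor_of_maps scale [?f, ?id, ?id, ?id] M) \<cdot>\<^sub>7 \<M> 1 2 3 4"
    using exchange[of 0 3] unfolding places \<rho> by (simp add: mult7_def \<M>_def numeral_3_eq_3)
  moreover have "\<M> 4 5 6 7 \<cdot>\<^sub>7 tensor_of_maps scale [?id, ?id, ?id, ?f] M
      = permute_tensor scale 7 \<sigma> (tensor_of_maps scale [?id, ?id, ?id, ?f] M) \<cdot>\<^sub>7 \<M> 4 5 6 7"
    using exchange[of 3 0] unfolding places \<sigma> by (simp add: mult7_def \<M>_def numeral_3_eq_3)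
  moreover have
    "permute_tensor scale 7 \<rho> (\<M> 1 5 6 7) = \<M> 1 5 6 7"
    "permute_tensor scale 7 \<rho> (\<M> 2 5 6 7) = \<M> 3 5 6 7"
    "permute_tensor scale 7 \<rho> (\<M> 3 5 6 7) = \<M> 2 5 6 7"
    "permute_tensor scale 7 \<rho> (\<M> 4 5 6 7) = \<M> 4 5 6 7"
    by (rule perm_\<M>; use perm in \<open>simp add: \<rho>_def\<close>)+
  moreover have
    "permute_tensor scale 7 \<sigma> (\<M> 1 2 3 4) = \<M> 1 2 3 4"
    "permute_tensor scale 7 \<sigma> (\<M> 1 2 3 6) = \<M> 1 2 3 5"
    "permute_tensor scale 7 \<sigma> (\<M> 1 2 3 5) = \<M> 1 2 3 6"
    "permute_tensor scale 7 \<sigma> (\<M> 1 2 3 7) = \<M> 1 2 3 7"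
    by (rule perm_\<M>; use perm in \<open>simp add: \<sigma>_def\<close>)+
  ultimately show ?thesis
    unfolding assms(9,10) using perm by (simp add: assoc closed7 \<M> perm_mult)
qed

end
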